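(* Let $n\ge1$, $1\le m\le n$, and let $\{\tilde A_k\}_{k=1}^{2^n+1}$ be a maximal complementary set of Abelian subgroups of $\widetilde{\mathcal P}_n$ of dimension $m$ (that is, a complementary family of $2^n+1$ Abelian subgroups, each of dimension $m$). Then for every pure state $\psi\in\mathbb{CP}^{2^n-1}$ the collision entropy satisfies $$\frac{1}{2^n+1}\sum_{k=1}^{2^n+1}H_2(\tilde A_k\mid\psi)\ \ge\ \log\left(\frac{2^n+1}{2^{n-m}+1}\right).$$
   Context: $\widetilde{\mathcal P}_n=\{\mathbb 1,X,Y,Z\}^{\otimes n}$ is the set of the $4^n$ Hermitian $n$-qubit Pauli operators on $\mathbb C^{2^n}$, and $\mathcal P_n$ is the Pauli group they generate (phases $\pm1,\pm i$). An Abelian subgroup $A$ of $\widetilde{\mathcal P}_n$ means a commutative subgroup $A<\mathcal P_n$ with $A\subset\pm\widetilde{\mathcal P}_n$ and $-\mathbb 1\notin A$; then $A\cong\mathbb Z_2^m$ for some $0\le m\le n$, called its dimension. Subgroups differing only by signs of elements are identified. Choosing independent generators $P_1,\dots,P_m$ of $A$, set $\Pi^A_x=\prod_{k=1}^m\frac{\mathbb 1+(-1)^{x_k}P_k}{2}$ and $p^A_\rho(x)=\mathrm{tr}[\Pi^A_x\rho]$ for $x\in\mathbb Z_2^m$ and $\rho$ a density operator on $\mathbb C^{2^n}$; for a pure state $\psi$ one puts $\rho=|\psi\rangle\langle\psi|$ and writes $p^A_\psi$. The state $\rho$ is a state of maximal information in $A$ if $p^A_\rho(x)=\delta_{xx_0}$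 for some $x_0$, and is unbiased in $A$ if $p^A_\rho(x)=2^{-m}$ for all $x$. Two Abelian subgroups $A,B$ are complementary if every state of maximal information in $A$ is unbiased in $B$ and every state of maximal information in $B$ is unbiased in $A$. A family $\{A_k\}_k$ is complementary if $A_k,A_l$ are complementary for all $k\neq l$. The collision entropy of $A$ in the state $\psi$ is $H_2(A\mid\psi):=-\log\big(\sum_{x\in\mathbb Z_2^m}p^A_\psi(x)^2\big)$, with $\log$ to the same fixed base ($>1$) throughout (independent of generators and signs). *)

theory Defs
  imports
    Complex_Main
    "HOL-Algebra.Product_Groups"
    "HOL-Algebra.Generated_Groups"
    "Jordan_Normal_Form.Matrix"
    "Jordan_Normal_Form.Schur_Decomposition"
begin

subsection \<open>Pauli operators and the Pauli group\<close>

(* Kronecker product; row and column indices of the left factor are the more significant ones. *)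
definition kron :: "complex mat \<Rightarrow> complex mat \<Rightarrow> complex mat" where
  "kron P Q = mat (dim_row P * dim_row Q) (dim_col P * dim_col Q)
     (\<lambda>(i, j). P $$ (i div dim_row Q, j div dim_col Q) * Q $$ (i mod dim_row Q, j mod dim_col Q))"

definition pauli_X :: "complex mat" where
  "pauli_X = mat_of_rows_list 2 [[0, 1], [1, 0]]"

definition pauli_Y :: "complex mat" where
  "pauli_Y = mat_of_rows_list 2 [[0, - \<i>], [\<i>, 0]]"

definition pauli_Z :: "complex mat" where
  "pauli_Z = mat_of_rows_list 2 [[1, 0], [0, - 1]]"

primrec pauli_ops :: "nat \<Rightarrow> complex mat set" where
  "pauli_ops 0 = {1\<^sub>m 1}"
| "pauli_ops (Suc n) =
     {kron P Q | P Q. P \<in> {1\<^sub>m 2, pauli_X, pauli_Y, pauli_Z} \<and> Q \<in> pauli_ops n}"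

definition GL :: "nat \<Rightarrow> complex mat monoid" where
  "GL d = units_of (ring_mat TYPE(complex) d ())"

definition pauli_group :: "nat \<Rightarrow> complex mat monoid" where
  "pauli_group n = (GL (2 ^ n))\<lparr>carrier := generate (GL (2 ^ n)) (pauli_ops n)\<rparr>"

definition abelian_pauli_subgroup :: "nat \<Rightarrow> complex mat set \<Rightarrow> bool" where
  "abelian_pauli_subgroup n A \<longleftrightarrow>
     subgroup A (pauli_group n) \<and>
     (\<forall>P\<in>A. \<forall>Q\<in>A. P * Q = Q * P) \<and>
     A \<subseteq> pauli_ops n \<union> uminus ` pauli_ops n \<and>
     - 1\<^sub>m (2 ^ n) \<notin> A"

definition Z2_power :: "nat \<Rightarrow> (nat \<Rightarrow> int) monoid" where
  "Z2_power m = product_group {..<m} (\<lambda>_. integer_mod_group 2)"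

definition has_pauli_dim :: "nat \<Rightarrow> complex mat set \<Rightarrow> nat \<Rightarrow> bool" where
  "has_pauli_dim n A m \<longleftrightarrow> (pauli_group n)\<lparr>carrier := A\<rparr> \<cong> Z2_power m"

definition independent_generators :: "nat \<Rightarrow> complex mat set \<Rightarrow> complex mat list \<Rightarrow> bool" where
  "independent_generators n A Ps \<longleftrightarrow>
     generate (pauli_group n) (set Ps) = A \<and>
     set Ps \<subseteq> A \<and>
     (\<forall>k<length Ps. Ps ! k \<notin> generate (pauli_group n) {Ps ! j | j. j < length Ps \<and> j \<noteq> k})"

(* A fixed but arbitrary choice of generators. Another choice, or changing the signs of elements
   of A, only permutes the outcomes x below by an affine bijection of the group Z2_power m. The
   length of the list is the dimension of A. *)
definition pauli_gens :: "nat \<Rightarrow> complex mat set \<Rightarrow> complex mat list" where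
  "pauli_gens n A = (SOME Ps. independent_generators n A Ps)"

definition outcomes :: "nat \<Rightarrow> complex mat set \<Rightarrow> (nat \<Rightarrow> int) set" where
  "outcomes n A = carrier (Z2_power (length (pauli_gens n A)))"

subsection \<open>States and measurement statistics\<close>

definition mat_trace :: "complex mat \<Rightarrow> complex" where
  "mat_trace M = (\<Sum>i<dim_row M. M $$ (i, i))"

(* The order on complex numbers is that of Complex_Order: 0 <= z says that z is real and
   nonnegative. *)
definition density_operator :: "nat \<Rightarrow> complex mat \<Rightarrow> bool" where
  "density_operator n \<rho> \<longleftrightarrow>
     \<rho> \<in> carrier_mat (2 ^ n) (2 ^ n) \<and>
     mat_adjoint \<rho> = \<rho> \<and>
     (\<forall>v\<in>carrier_vec (2 ^ n). 0 \<le> (\<rho> *\<^sub>v v) \<bullet>c v) \<and>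
     mat_trace \<rho> = 1"

(* Points of the projective space are represented by unit vectors. *)
definition pure_state :: "nat \<Rightarrow> complex vec \<Rightarrow> bool" where
  "pure_state n \<psi> \<longleftrightarrow> \<psi> \<in> carrier_vec (2 ^ n) \<and> \<psi> \<bullet>c \<psi> = 1"

definition ketbra :: "complex vec \<Rightarrow> complex mat" where
  "ketbra \<psi> = mat (dim_vec \<psi>) (dim_vec \<psi>) (\<lambda>(i, j). \<psi> $ i * cnj (\<psi> $ j))"

definition joint_projector :: "nat \<Rightarrow> complex mat set \<Rightarrow> (nat \<Rightarrow> int) \<Rightarrow> complex mat" where
  "joint_projector n A x =
     foldr (\<lambda>k M. ((1 / 2) \<cdot>\<^sub>m (1\<^sub>m (2 ^ n) + ((- 1) powi x k) \<cdot>\<^sub>m (pauli_gens n A ! k))) * M)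
       [0..<length (pauli_gens n A)] (1\<^sub>m (2 ^ n))"

definition outcome_prob ::
  "nat \<Rightarrow> complex mat set \<Rightarrow> complex mat \<Rightarrow> (nat \<Rightarrow> int) \<Rightarrow> real" where
  "outcome_prob n A \<rho> x = Re (mat_trace (joint_projector n A x * \<rho>))"

definition max_information :: "nat \<Rightarrow> complex mat set \<Rightarrow> complex mat \<Rightarrow> bool" where
  "max_information n A \<rho> \<longleftrightarrow>
     (\<exists>x\<^sub>0\<in>outcomes n A. \<forall>x\<in>outcomes n A. outcome_prob n A \<rho> x = (if x = x\<^sub>0 then 1 else 0))"

definition unbiased :: "nat \<Rightarrow> complex mat set \<Rightarrow> complex mat \<Rightarrow> bool" where
  "unbiased n A \<rho> \<longleftrightarrow>
     (\<forall>x\<in>outcomes n A. outcome_prob n A \<rho> x = 1 / 2 ^ length (pauli_gens n A))"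

definition complementary :: "nat \<Rightarrow> complex mat set \<Rightarrow> complex mat set \<Rightarrow> bool" where
  "complementary n A B \<longleftrightarrow>
     (\<forall>\<rho>. density_operator n \<rho> \<and> max_information n A \<rho> \<longrightarrow> unbiased n B \<rho>) \<and>
     (\<forall>\<rho>. density_operator n \<rho> \<and> max_information n B \<rho> \<longrightarrow> unbiased n A \<rho>)"

definition complementary_family ::
  "nat \<Rightarrow> 'i set \<Rightarrow> ('i \<Rightarrow> complex mat set) \<Rightarrow> bool" where
  "complementary_family n I A \<longleftrightarrow> (\<forall>k\<in>I. \<forall>l\<in>I. k \<noteq> l \<longrightarrow> complementary n (A k) (A l))"

definition collision_entropy ::
  "real \<Rightarrow> nat \<Rightarrow> complex mat set \<Rightarrow> complex vec \<Rightarrow> real" where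
  "collision_entropy b n A \<psi> = - log b (\<Sum>x\<in>outcomes n A. (outcome_prob n A (ketbra \<psi>) x)\<^sup>2)"

end

theory Submission
  imports Defs
begin

text \<open>
  Write \<open>N = 2 ^ n\<close> and \<open>M = 2 ^ m\<close>. Applying complementarity to pure states in the range of an outcome
  projection \<open>P\<close> of one subgroup shows \<open>P * Q * P = P / M\<close> for every outcome projection \<open>Q\<close> of another
  one. Hence all outcome projections have trace \<open>N / M\<close>, and the Hilbert-Schmidt inner products of their
  symmetrized tensor squares are known. With \<open>N + 1\<close> subgroups these inner products force the sum of
  all symmetrized squares to be \<open>N / M + 1\<close> times that of the identity, so the projections
  behave like a complex projective 2-design. Evaluated at a unit vector, this says that the collision
  probabilities of the \<open>N + 1\<close> subgroups always add up to exactly \<open>N / M + 1\<close>, and convexity of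
  the negative logarithm gives the bound.
\<close>

subsection \<open>Pauli operators and independent generators\<close>

text \<open>What the measurements inherit from the Pauli operators is that the chosen generators are
  pairwise commuting Hermitian involutions and that there are exactly \<open>m\<close> of them. The
  number needs an argument: dimension is defined by an isomorphism with \<open>Z2_power m\<close>,
  generators by an arbitrary choice, and the two meet only in the order of the subgroup.

  The trace \<open>N / M\<close> is not computed from traces of Pauli operators. For projections
  \<open>P\<close>, \<open>Q\<close> of two different subgroups, \<open>P * Q * P = P / M\<close>
  and its mirror image give \<open>tr P / M = tr (P * Q) = tr Q / M\<close>; so all these traces
  agree, and within one subgroup they add up to \<open>N\<close>.

  The inner product of the squares of \<open>X\<close> and \<open>Y\<close> is
  \<open>2 * ((tr (X * Y))^2 + tr (X * Y * X * Y))\<close>, and both terms are known once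
  \<open>P * Q * P\<close> is. The constant is forced: with \<open>r = N / M\<close>, the inner
  product of the total with the square of the identity, divided by the squared norm of the latter,
  is \<open>(N + 1) * M * (r^2 + r) / (N^2 + N) = r + 1\<close>.\<close>

lemma sum_div_mod_times:
  fixes f :: "nat \<Rightarrow> nat \<Rightarrow> 'a::comm_monoid_add"
  shows "(\<Sum>k<a * b. f (k div b) (k mod b)) = (\<Sum>i<a. \<Sum>j<b. f i j)"
proof (cases "b = 0")
  case False
  have "(\<Sum>k<a * b. f (k div b) (k mod b)) = (\<Sum>m<a. \<Sum>k = m * b..<m * b + b. f (k div b) (k mod b))"
    by (simp only: sum.nat_group[symmetric])
  also have "\<dots> = (\<Sum>i<a. \<Sum>j<b. f i j)"
  proof (rule sum.cong[OF refl])
    fix m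
    show "(\<Sum>k = m * b..<m * b + b. f (k div b) (k mod b)) = (\<Sum>j<b. f m j)"
      by (rule sum.reindex_bij_witness[of _ "\<lambda>j. m * b + j" "\<lambda>k. k - m * b"])
        (use False in \<open>auto simp: div_nat_eqI[of m b] mod_nat_eqI add.commute less_diff_conv2 mult.commute
          intro!: arg_cong2[of _ _ _ _ f] div_nat_eqI[symmetric] mod_nat_eqI[symmetric]\<close>)
  qed
  finally show ?thesis .
qed simp

section \<open>Kronecker products and Hermitian involutions\<close>

lemma kron_carrier [intro]:
  "P \<in> carrier_mat a b \<Longrightarrow> Q \<in> carrier_mat c d \<Longrightarrow> kron P Q \<in> carrier_mat (a * c) (b * d)"
  by (auto simp: kron_def)

lemma kron_mult:
  assumes "P \<in> carrier_mat a b" "P' \<in> carrier_mat b c" "Q \<in> carrier_mat a' b'" "Q' \<in> carrier_mat b' c'"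
  shows "kron P Q * kron P' Q' = kron (P * P') (Q * Q')"
proof (rule eq_matI)
  fix i j assume "i < dim_row (kron (P * P') (Q * Q'))" "j < dim_col (kron (P * P') (Q * Q'))"
  then have i: "i < a * a'" and j: "j < c * c'" using assms by (auto simp: kron_def)
  then have "a' > 0" "c' > 0" by (auto intro: gr0I)
  with i j have *: "i div a' < a" "i mod a' < a'" "j div c' < c" "j mod c' < c'"
    by (auto simp: less_mult_imp_div_less)
  have "(kron P Q * kron P' Q') $$ (i, j) = (\<Sum>k<b * b'. (P $$ (i div a', k div b') * Q $$ (i mod a', k mod b')) *
     (P' $$ (k div b', j div c') * Q' $$ (k mod b', j mod c')))"
    using assms i j by (simp add: kron_def scalar_prod_def lessThan_atLeast0)
  also have "\<dots> = (\<Sum>k<b. \<Sum>l<b'. (P $$ (i div a', k) * Q $$ (i mod a', l)) *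
     (P' $$ (k, j div c') * Q' $$ (l, j mod c')))"
    by (rule sum_div_mod_times)
  also have "\<dots> = (\<Sum>k<b. P $$ (i div a', k) * P' $$ (k, j div c')) * (\<Sum>l<b'. Q $$ (i mod a', l) * Q' $$ (l, j mod c'))"
    by (simp add: sum_product mult_ac)
  also have "\<dots> = kron (P * P') (Q * Q') $$ (i, j)"
    using assms i j * by (simp add: kron_def scalar_prod_def lessThan_atLeast0)
  finally show "(kron P Q * kron P' Q') $$ (i, j) = kron (P * P') (Q * Q') $$ (i, j)" .
qed (use assms in \<open>auto simp: kron_def\<close>)

lemma kron_one: "kron (1\<^sub>m a) (1\<^sub>m b) = 1\<^sub>m (a * b)"
proof (rule eq_matI)
  fix i j assume "i < dim_row (1\<^sub>m (a * b) :: complex mat)" "j < dim_col (1\<^sub>m (a * b) :: complex mat)"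
  then have i: "i < a * b" and j: "j < a * b" by auto
  then have "b > 0" by (auto intro: gr0I)
  with i j have "i div b < a" "j div b < a" "i mod b < b" "j mod b < b"
    by (auto simp: less_mult_imp_div_less)
  moreover have "i = j" if "i div b = j div b" "i mod b = j mod b"
    using that by (metis div_mult_mod_eq)
  ultimately show "kron (1\<^sub>m a) (1\<^sub>m b) $$ (i, j) = 1\<^sub>m (a * b) $$ (i, j)"
    using i j by (auto simp: kron_def)
qed (auto simp: kron_def)

text \<open>Entrywise rather than through \<open>mat_adjoint\<close>, because it serves to trade a
  conjugated entry for the transposed one in coordinate sums.\<close>

definition hermitian_mat :: "nat \<Rightarrow> complex mat \<Rightarrow> bool" where
  "hermitian_mat N X \<longleftrightarrow> X \<in> carrier_mat N N \<and> (\<forall>i<N. \<forall>j<N. X $$ (j, i) = cnj (X $$ (i, j)))"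

lemma hermitian_mat_carrier: "hermitian_mat N X \<Longrightarrow> X \<in> carrier_mat N N"
  by (simp add: hermitian_mat_def)

lemma hermitian_mat_entry:
  "hermitian_mat N X \<Longrightarrow> i < N \<Longrightarrow> j < N \<Longrightarrow> X $$ (j, i) = cnj (X $$ (i, j))"
  unfolding hermitian_mat_def by blast

lemma hermitian_one: "hermitian_mat N (1\<^sub>m N)"
  by (auto simp: hermitian_mat_def)

lemma hermitian_kron:
  assumes "hermitian_mat a P" "hermitian_mat b Q"
  shows "hermitian_mat (a * b) (kron P Q)"
  unfolding hermitian_mat_def
proof (intro conjI allI impI)
  show "kron P Q \<in> carrier_mat (a * b) (a * b)"
    using assms[THEN hermitian_mat_carrier] by auto
  fix i j assume i: "i < a * b" and j: "j < a * b"
  then have "b > 0" by (auto intro: gr0I)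
  with i j have *: "i div b < a" "j div b < a" "i mod b < b" "j mod b < b"
    by (auto simp: less_mult_imp_div_less)
  then have "P $$ (j div b, i div b) = cnj (P $$ (i div b, j div b))"
    "Q $$ (j mod b, i mod b) = cnj (Q $$ (i mod b, j mod b))"
    using hermitian_mat_entry[OF assms(1)] hermitian_mat_entry[OF assms(2)] by blast+
  then show "kron P Q $$ (j, i) = cnj (kron P Q $$ (i, j))"
    using i j assms[THEN hermitian_mat_carrier] by (auto simp: kron_def)
qed

lemma hermitian_uminus: "hermitian_mat N X \<Longrightarrow> hermitian_mat N (- X)"
proof -
  assume X: "hermitian_mat N X"
  show "hermitian_mat N (- X)"
    unfolding hermitian_mat_def
  proof (intro conjI allI impI)
    fix i j assume "i < N" "j < N"
    with hermitian_mat_entry[OF X this] hermitian_mat_carrier[OF X]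
    show "(- X) $$ (j, i) = cnj ((- X) $$ (i, j))" by auto
  qed (use hermitian_mat_carrier[OF X] in auto)
qed

lemma pauli_matrix_hermitian_involution:
  assumes "P \<in> {1\<^sub>m 2, pauli_X, pauli_Y, pauli_Z}"
  shows "hermitian_mat 2 P" "P * P = 1\<^sub>m 2"
proof -
  have r: "(\<forall>i<2. Q i) \<longleftrightarrow> Q 0 \<and> Q (1::nat)" for Q by (auto simp: less_2_cases_iff)
  show "hermitian_mat 2 P"
    using assms unfolding hermitian_mat_def r
    by (auto simp: pauli_X_def pauli_Y_def pauli_Z_def mat_of_rows_list_def)
  show "P * P = 1\<^sub>m 2"
    using assms
    by (auto intro!: eq_matI simp: pauli_X_def pauli_Y_def pauli_Z_def mat_of_rows_list_def
        scalar_prod_def less_2_cases_iff)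
qed

lemma pauli_ops_hermitian_involution:
  assumes "P \<in> pauli_ops n"
  shows "hermitian_mat (2 ^ n) P \<and> P * P = 1\<^sub>m (2 ^ n)"
  using assms
proof (induction n arbitrary: P)
  case (Suc n)
  then obtain R Q where P: "P = kron R Q" and R: "R \<in> {1\<^sub>m 2, pauli_X, pauli_Y, pauli_Z}" and Q: "Q \<in> pauli_ops n"
    by (auto simp only: pauli_ops.simps)
  have "R \<in> carrier_mat 2 2" "Q \<in> carrier_mat (2 ^ n) (2 ^ n)"
    using pauli_matrix_hermitian_involution(1)[OF R] Suc.IH[OF Q] hermitian_mat_carrier by auto
  then have "P * P = 1\<^sub>m (2 ^ Suc n)"
    using pauli_matrix_hermitian_involution(2)[OF R] Suc.IH[OF Q] by (simp add: P kron_mult kron_one)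
  then show ?case
    using hermitian_kron[OF pauli_matrix_hermitian_involution(1)[OF R]] Suc.IH[OF Q] by (auto simp: P)
qed (auto simp: hermitian_mat_def)

section \<open>The Pauli group and its signed elements\<close>

lemma group_GL: "group (GL d)"
proof -
  interpret ring "ring_mat TYPE(complex) d ()" by (rule ring_mat)
  show ?thesis unfolding GL_def by (rule units_group)
qed

lemma GL_simps: "monoid.mult (GL d) = (*)" "\<one>\<^bsub>GL d\<^esub> = 1\<^sub>m d"
  by (auto simp: GL_def units_of_def ring_mat_simps)

text \<open>Each Pauli operator is its own inverse.\<close>

lemma pauli_ops_GL: "pauli_ops n \<subseteq> carrier (GL (2 ^ n))"
  using pauli_ops_hermitian_involution hermitian_mat_carrier by (fastforce simp: GL_def units_of_def Units_def ring_mat_simps)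

lemma group_pauli_group: "group (pauli_group n)"
  unfolding pauli_group_def
  by (intro group.subgroup_imp_group group_GL group.generate_is_subgroup pauli_ops_GL)

lemma pauli_group_simps: "monoid.mult (pauli_group n) = (*)" "\<one>\<^bsub>pauli_group n\<^esub> = 1\<^sub>m (2 ^ n)"
  by (auto simp: pauli_group_def GL_simps)

lemma abelian_pauli_subgroup_elem:
  assumes "abelian_pauli_subgroup n A" "P \<in> A"
  shows "hermitian_mat (2 ^ n) P" "P * P = 1\<^sub>m (2 ^ n)"
proof -
  from assms consider "P \<in> pauli_ops n" | Q where "P = - Q" "Q \<in> pauli_ops n"
    unfolding abelian_pauli_subgroup_def by blast
  then have "hermitian_mat (2 ^ n) P \<and> P * P = 1\<^sub>m (2 ^ n)"
  proof cases
    case (2 Q)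
    then have "Q \<in> carrier_mat (2 ^ n) (2 ^ n)" using pauli_ops_hermitian_involution hermitian_mat_carrier by blast
    with 2 show ?thesis using pauli_ops_hermitian_involution[of Q n] by (auto simp: hermitian_uminus)
  qed (use pauli_ops_hermitian_involution in auto)
  then show "hermitian_mat (2 ^ n) P" "P * P = 1\<^sub>m (2 ^ n)" by auto
qed

section \<open>Orders of groups generated by commuting involutions\<close>

lemma (in group) subgroup_insert_involution:
  assumes H: "subgroup H G" and a: "a \<in> carrier G" "a \<otimes> a = \<one>"
    and comm: "\<And>h. h \<in> H \<Longrightarrow> a \<otimes> h = h \<otimes> a"
  shows "generate G (insert a H) = H \<union> (\<lambda>h. a \<otimes> h) ` H"
proof
  interpret H: subgroup H G by (rule H)
  have inva: "inv a = a" using a by (simp add: inv_equality)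
  have "subgroup (H \<union> (\<lambda>h. a \<otimes> h) ` H) G"
  proof (rule subgroupI)
    have m: "(a \<otimes> h) \<otimes> k = a \<otimes> (h \<otimes> k)" "h \<otimes> (a \<otimes> k) = a \<otimes> (h \<otimes> k)"
      "(a \<otimes> h) \<otimes> (a \<otimes> k) = h \<otimes> k" if "h \<in> H" "k \<in> H" for h k
    proof -
      show 1: "(a \<otimes> h) \<otimes> k = a \<otimes> (h \<otimes> k)" using that a by (simp add: m_assoc)
      show 2: "h \<otimes> (a \<otimes> k) = a \<otimes> (h \<otimes> k)"
        using that a by (metis H.mem_carrier comm m_assoc)
      have "(a \<otimes> h) \<otimes> (a \<otimes> k) = a \<otimes> (a \<otimes> (h \<otimes> k))"
        using that a 2 by (simp add: m_assoc)
      also have "\<dots> = h \<otimes> k" using that a by (simp add: m_assoc[symmetric])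
      finally show "(a \<otimes> h) \<otimes> (a \<otimes> k) = h \<otimes> k" .
    qed
    show "x \<otimes> y \<in> H \<union> (\<lambda>h. a \<otimes> h) ` H" if "x \<in> H \<union> (\<lambda>h. a \<otimes> h) ` H" "y \<in> H \<union> (\<lambda>h. a \<otimes> h) ` H" for x y
      using that by (auto simp: m)
    show "inv x \<in> H \<union> (\<lambda>h. a \<otimes> h) ` H" if "x \<in> H \<union> (\<lambda>h. a \<otimes> h) ` H" for x
      using that a by (auto simp: inv_mult_group inva comm[symmetric])
  qed (use a H.one_closed in \<open>auto simp del: H.one_closed\<close>)
  then show "generate G (insert a H) \<subseteq> H \<union> (\<lambda>h. a \<otimes> h) ` H"
    by (rule generate_subgroup_incl[rotated]) (use a in \<open>force intro: image_eqI[of a _ \<one>]\<close>)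
  show "H \<union> (\<lambda>h. a \<otimes> h) ` H \<subseteq> generate G (insert a H)"
    by (auto intro: generate.incl generate.eng[OF generate.incl generate.incl])
qed

text \<open>The cosets \<open>H\<close> and \<open>a H\<close> are disjoint, since
  \<open>a \<otimes> h\<close> in \<open>H\<close> would put \<open>a\<close> itself into
  \<open>H\<close>, and left multiplication by \<open>a\<close> is injective.\<close>

lemma (in group) card_subgroup_insert_involution:
  assumes H: "subgroup H G" and a: "a \<in> carrier G" "a \<otimes> a = \<one>" "a \<notin> H"
    and comm: "\<And>h. h \<in> H \<Longrightarrow> a \<otimes> h = h \<otimes> a" and fin: "finite H"
  shows "card (generate G (insert a H)) = 2 * card H"
proof -
  interpret H: subgroup H G by (rule H)
  have "H \<inter> (\<lambda>h. a \<otimes> h) ` H = {}"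
  proof -
    have False if "h \<in> H" "a \<otimes> h \<in> H" for h
    proof -
      have "a = (a \<otimes> h) \<otimes> inv h" using a that by (simp add: m_assoc)
      also have "\<dots> \<in> H" using that by blast
      finally show False using a by simp
    qed
    then show ?thesis by auto
  qed
  moreover have "inj_on (\<lambda>h. a \<otimes> h) H"
    using a by (auto intro!: inj_onI)
  ultimately show ?thesis
    using fin by (simp add: subgroup_insert_involution[OF H a(1,2) comm] card_Un_disjoint card_image)
qed

text \<open>Each generator lies outside the group of its predecessors and hence doubles the order.
  Prefixes of the list make this an induction.\<close>

lemma (in group) card_generate_independent:
  assumes Ps: "set Ps \<subseteq> carrier G" and inv2: "\<And>P. P \<in> set Ps \<Longrightarrow> P \<otimes> P = \<one>"
    and comm: "\<And>P Q. P \<in> generate G (set Ps) \<Longrightarrow> Q \<in> generate G (set Ps) \<Longrightarrow> P \<otimes> Q = Q \<otimes> P"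
    and indep: "\<And>k. k < length Ps \<Longrightarrow> Ps ! k \<notin> generate G {Ps ! j | j. j < length Ps \<and> j \<noteq> k}"
    and "j \<le> length Ps"
  shows "finite (generate G (set (take j Ps))) \<and> card (generate G (set (take j Ps))) = 2 ^ j"
  using \<open>j \<le> length Ps\<close>
proof (induction j)
  case 0
  then show ?case by (simp add: generate_empty)
next
  case (Suc j)
  let ?H = "generate G (set (take j Ps))" and ?a = "Ps ! j"
  from Suc have j: "j < length Ps" by simp
  have sub: "set (take j Ps) \<subseteq> set Ps" by (rule set_take_subset)
  have H: "subgroup ?H G" using Ps sub by (intro generate_is_subgroup) auto
  have aP: "?a \<in> set Ps" using j by simp
  have HP: "?H \<subseteq> generate G (set Ps)" by (rule mono_generate[OF sub])
  \<comment> \<open>Independence excludes the group generated by all other entries, which contains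
    the group generated by the earlier ones.\<close>
  have "set (take j Ps) \<subseteq> {Ps ! i | i. i < length Ps \<and> i \<noteq> j}"
    using j by (force simp: in_set_conv_nth)
  then have a: "?a \<notin> ?H" using indep[OF j] mono_generate by blast
  \<comment> \<open>Replacing the earlier generators by the whole group \<open>?H\<close> brings the
    step into the form of the doubling lemma.\<close>
  have ex: "generate G (set (take (Suc j) Ps)) = generate G (insert ?a ?H)"
  proof
    have "set (take (Suc j) Ps) \<subseteq> insert ?a ?H"
      using j by (auto simp: take_Suc_conv_app_nth intro: generate.incl)
    then show "generate G (set (take (Suc j) Ps)) \<subseteq> generate G (insert ?a ?H)"
      by (rule mono_generate)
    have "insert ?a ?H \<subseteq> generate G (set (take (Suc j) Ps))"
      using j mono_generate[of "set (take j Ps)" "set (take (Suc j) Ps)"]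
      by (auto simp: take_Suc_conv_app_nth intro: generate.incl)
    moreover have "subgroup (generate G (set (take (Suc j) Ps))) G"
      using Ps by (intro generate_is_subgroup) (meson order_trans set_take_subset)
    ultimately show "generate G (insert ?a ?H) \<subseteq> generate G (set (take (Suc j) Ps))"
      by (rule generate_subgroup_incl)
  qed
  have a': "?a \<in> carrier G" "?a \<otimes> ?a = \<one>" using aP Ps inv2 by auto
  have comm': "?a \<otimes> h = h \<otimes> ?a" if "h \<in> ?H" for h
    using comm[OF generate.incl[OF aP], of h] that HP by blast
  have "card (generate G (insert ?a ?H)) = 2 * card ?H"
    using Suc by (intro card_subgroup_insert_involution[OF H a' a comm']) auto
  moreover have "finite (generate G (insert ?a ?H))"
    using Suc by (simp add: subgroup_insert_involution[OF H a' comm'])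
  ultimately show ?case using Suc by (simp add: ex)
qed

text \<open>A generating subset of least size works: a member generated by the others could be
  dropped, leaving a smaller generating set.\<close>

lemma ex_independent_generators:
  assumes A: "abelian_pauli_subgroup n A" and fin: "finite A"
  shows "\<exists>Ps. independent_generators n A Ps"
proof -
  interpret group "pauli_group n" by (rule group_pauli_group)
  let ?gen = "generate (pauli_group n)"
  have sub: "subgroup A (pauli_group n)" using A by (simp add: abelian_pauli_subgroup_def)
  then have AG: "A \<subseteq> carrier (pauli_group n)" by (rule subgroup.subset)
  let ?P = "\<lambda>S. S \<subseteq> A \<and> ?gen S = A"
  have "?P A" using generate_subgroup_incl[OF order_refl sub] by (auto intro: generate.incl)
  then obtain S where S: "?P S" and min: "\<And>S'. ?P S' \<Longrightarrow> card S \<le> card S'"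
    using ex_has_least_nat[of ?P A card] by blast
  from S fin have "finite S" by (auto intro: finite_subset)
  then obtain Ps where Ps: "set Ps = S" "distinct Ps" using finite_distinct_list by auto
  have "Ps ! k \<notin> ?gen {Ps ! j | j. j < length Ps \<and> j \<noteq> k}" if k: "k < length Ps" for k
  proof
    \<comment> \<open>Independence speaks of list positions, minimality of elements; distinctness of
      \<open>Ps\<close> makes omitting a position the same as removing its element.\<close>
    have eq: "{Ps ! j | j. j < length Ps \<and> j \<noteq> k} = S - {Ps ! k}"
      using Ps k by (auto simp: in_set_conv_nth nth_eq_iff_index_eq)
    assume "Ps ! k \<in> ?gen {Ps ! j | j. j < length Ps \<and> j \<noteq> k}"
    then have "S \<subseteq> ?gen (S - {Ps ! k})" unfolding eq by (auto intro: generate.incl)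
    moreover have "subgroup (?gen (S - {Ps ! k})) (pauli_group n)"
      using S AG by (intro generate_is_subgroup) auto
    ultimately have "?gen S \<subseteq> ?gen (S - {Ps ! k})" by (rule generate_subgroup_incl)
    moreover have "?gen (S - {Ps ! k}) \<subseteq> ?gen S" by (rule mono_generate) auto
    ultimately have "?P (S - {Ps ! k})" using S by auto
    then have "card S \<le> card (S - {Ps ! k})" by (rule min)
    moreover have "Ps ! k \<in> S" using Ps k by auto
    ultimately show False using \<open>finite S\<close> by (metis card_Diff1_less not_le)
  qed
  then have "independent_generators n A Ps"
    using S Ps by (auto simp: independent_generators_def)
  then show ?thesis ..
qed

lemma carrier_Z2_power: "carrier (Z2_power m) = {..<m} \<rightarrow>\<^sub>E {0, 1}"
  by (auto simp: Z2_power_def carrier_integer_mod_group intro!: PiE_cong)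

lemma card_carrier_Z2_power: "finite (carrier (Z2_power m)) \<and> card (carrier (Z2_power m)) = 2 ^ m"
  unfolding carrier_Z2_power by (auto simp: card_PiE numeral_2_eq_2 intro!: finite_PiE)

text \<open>The order of \<open>A\<close> is counted twice: \<open>2 ^ m\<close> from the
  isomorphism, and 2 to the length of the list from the independent generators.\<close>

lemma pauli_gens_subset_length:
  assumes A: "abelian_pauli_subgroup n A" and dim: "has_pauli_dim n A m"
  shows "set (pauli_gens n A) \<subseteq> A" "length (pauli_gens n A) = m"
proof -
  interpret group "pauli_group n" by (rule group_pauli_group)
  from dim obtain h where "bij_betw h A (carrier (Z2_power m))"
    by (auto simp: has_pauli_dim_def is_iso_def iso_def)
  then have card: "finite A" "card A = 2 ^ m"
    using card_carrier_Z2_power[of m] by (auto simp: bij_betw_same_card bij_betw_finite)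
  let ?Ps = "pauli_gens n A"
  have ind: "independent_generators n A ?Ps"
    unfolding pauli_gens_def by (rule someI_ex, rule ex_independent_generators[OF A card(1)])
  then show sub: "set ?Ps \<subseteq> A" by (simp add: independent_generators_def)
  have AG: "A \<subseteq> carrier (pauli_group n)"
    using A by (intro subgroup.subset) (simp add: abelian_pauli_subgroup_def)
  have "card (generate (pauli_group n) (set (take (length ?Ps) ?Ps))) = 2 ^ length ?Ps"
    using ind sub A AG abelian_pauli_subgroup_elem(2)[OF A]
    by (intro card_generate_independent[THEN conjunct2])
      (auto simp: independent_generators_def pauli_group_simps abelian_pauli_subgroup_def)
  then have "2 ^ m = (2::nat) ^ length ?Ps"
    using ind card by (simp add: independent_generators_def)
  then show "length ?Ps = m" by (simp only: power_inject_exp one_less_numeral_iff semiring_norm)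
qed

subsection \<open>A design identity for complementary families of projections\<close>

lemma mat_trace_mult:
  assumes "X \<in> carrier_mat N M" "Y \<in> carrier_mat M N"
  shows "mat_trace (X * Y) = (\<Sum>i<N. \<Sum>j<M. X $$ (i, j) * Y $$ (j, i))"
  using assms by (auto simp: mat_trace_def scalar_prod_def lessThan_atLeast0)

lemma mat_trace_comm:
  assumes "X \<in> carrier_mat N M" "Y \<in> carrier_mat M N"
  shows "mat_trace (X * Y) = mat_trace (Y * X)"
  unfolding mat_trace_mult[OF assms] mat_trace_mult[OF assms(2,1)]
  by (subst sum.swap) (simp add: mult.commute)

lemma mat_trace_smult: "mat_trace (c \<cdot>\<^sub>m X) = c * mat_trace X" if "X \<in> carrier_mat N N"
  using that by (simp add: mat_trace_def sum_distrib_left)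

lemma mat_trace_add:
  assumes "X \<in> carrier_mat N N" "Y \<in> carrier_mat N N"
  shows "mat_trace (X + Y) = mat_trace X + mat_trace Y"
  using assms by (simp add: mat_trace_def sum.distrib)

lemma mat_trace_one: "mat_trace (1\<^sub>m N) = of_nat N"
  by (simp add: mat_trace_def)

lemma mat_trace_zero: "mat_trace (0\<^sub>m N N) = 0"
  by (simp add: mat_trace_def)

lemma mat_trace_ketbra:
  assumes "X \<in> carrier_mat N N" "v \<in> carrier_vec N"
  shows "mat_trace (X * ketbra v) = (X *\<^sub>v v) \<bullet>c v"
    and "(X *\<^sub>v v) \<bullet>c v = (\<Sum>a<N. \<Sum>b<N. X $$ (a, b) * v $ b * cnj (v $ a))"
proof -
  have *: "ketbra v \<in> carrier_mat N N" using assms by (auto simp: ketbra_def)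
  show 1: "(X *\<^sub>v v) \<bullet>c v = (\<Sum>a<N. \<Sum>b<N. X $$ (a, b) * v $ b * cnj (v $ a))"
    using assms by (auto simp: scalar_prod_def lessThan_atLeast0 sum_distrib_right)
  show "mat_trace (X * ketbra v) = (X *\<^sub>v v) \<bullet>c v"
    unfolding mat_trace_mult[OF assms(1) *] 1 using assms by (auto simp: ketbra_def mult.assoc)
qed

text \<open>With row pair \<open>(a, c)\<close> and column pair \<open>(b, d)\<close> these are the
  entries of the tensor square of \<open>X\<close> times \<open>1 + F\<close>, where
  \<open>F\<close> flips the two factors: twice the tensor square restricted to the symmetric
  subspace.\<close>

definition sym_square :: "complex mat \<Rightarrow> nat \<times> nat \<times> nat \<times> nat \<Rightarrow> complex" where
  "sym_square X = (\<lambda>(a, b, c, d). X $$ (a, b) * X $$ (c, d) + X $$ (a, d) * X $$ (c, b))"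

text \<open>Since \<open>F\<close> commutes with tensor squares and
  \<open>(1 + F)^2 = 2 * (1 + F)\<close>, the inner product is twice the trace of the tensor square
  of \<open>X * Y\<close> times \<open>1 + F\<close>. The summand \<open>1\<close> gives the squared
  trace, the flip the trace of the square.\<close>

lemma sym_square_inner:
  assumes X: "X \<in> carrier_mat N N" and Y: "hermitian_mat N Y"
  shows "(\<Sum>q\<in>{..<N} \<times> {..<N} \<times> {..<N} \<times> {..<N}. sym_square X q * cnj (sym_square Y q)) =
    2 * ((mat_trace (X * Y))\<^sup>2 + mat_trace ((X * Y) * (X * Y)))"
proof -
  have Yc: "Y \<in> carrier_mat N N" using Y by (rule hermitian_mat_carrier)
  \<comment> \<open>Multiplying out yields four products; exchanging \<open>b\<close> and
    \<open>d\<close> maps two of them to the other two, whence the factor 2.\<close>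
  define G where "G a b c d = X $$ (a, b) * X $$ (c, d) *
    (Y $$ (b, a) * Y $$ (d, c) + Y $$ (d, a) * Y $$ (b, c))" for a b c d
  have swap: "(\<Sum>b<N. \<Sum>c<N. \<Sum>d<N. g d c b) = (\<Sum>b<N. \<Sum>c<N. \<Sum>d<N. g b c d)"
    for g :: "nat \<Rightarrow> nat \<Rightarrow> nat \<Rightarrow> complex"
  proof -
    have "(\<Sum>b<N. \<Sum>c<N. \<Sum>d<N. g d c b) = (\<Sum>b<N. \<Sum>d<N. \<Sum>c<N. g d c b)"
      by (rule sum.cong[OF refl], rule sum.swap)
    also have "\<dots> = (\<Sum>d<N. \<Sum>b<N. \<Sum>c<N. g d c b)" by (rule sum.swap)
    also have "\<dots> = (\<Sum>d<N. \<Sum>c<N. \<Sum>b<N. g d c b)"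
      by (rule sum.cong[OF refl], rule sum.swap)
    finally show ?thesis .
  qed
  have "(\<Sum>q\<in>{..<N} \<times> {..<N} \<times> {..<N} \<times> {..<N}. sym_square X q * cnj (sym_square Y q)) =
    (\<Sum>a<N. \<Sum>b<N. \<Sum>c<N. \<Sum>d<N. sym_square X (a, b, c, d) * cnj (sym_square Y (a, b, c, d)))"
    by (simp add: sum.cartesian_product split_def)
  also have "\<dots> = (\<Sum>a<N. \<Sum>b<N. \<Sum>c<N. \<Sum>d<N. G a b c d + G a d c b)"
  proof (intro sum.cong refl)
    fix a b c d assume "a \<in> {..<N}" "b \<in> {..<N}" "c \<in> {..<N}" "d \<in> {..<N}"
    then have lt: "a < N" "b < N" "c < N" "d < N" by auto
    have "cnj (Y $$ (a, b)) = Y $$ (b, a)" "cnj (Y $$ (c, d)) = Y $$ (d, c)"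
      "cnj (Y $$ (a, d)) = Y $$ (d, a)" "cnj (Y $$ (c, b)) = Y $$ (b, c)"
      by (rule hermitian_mat_entry[OF Y, symmetric]; rule lt)+
    then show "sym_square X (a, b, c, d) * cnj (sym_square Y (a, b, c, d)) = G a b c d + G a d c b"
      by (simp add: sym_square_def G_def algebra_simps)
  qed
  also have "\<dots> = 2 * (\<Sum>a<N. \<Sum>b<N. \<Sum>c<N. \<Sum>d<N. G a b c d)"
  proof -
    have "(\<Sum>a<N. \<Sum>b<N. \<Sum>c<N. \<Sum>d<N. G a d c b) = (\<Sum>a<N. \<Sum>b<N. \<Sum>c<N. \<Sum>d<N. G a b c d)"
      by (rule sum.cong[OF refl], rule swap)
    then show ?thesis by (simp add: sum.distrib)
  qed
  also have "(\<Sum>a<N. \<Sum>b<N. \<Sum>c<N. \<Sum>d<N. G a b c d) =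
    (\<Sum>a<N. \<Sum>b<N. \<Sum>c<N. \<Sum>d<N. X $$ (a, b) * Y $$ (b, a) * (X $$ (c, d) * Y $$ (d, c))) +
    (\<Sum>a<N. \<Sum>b<N. \<Sum>c<N. \<Sum>d<N. X $$ (a, b) * Y $$ (b, c) * (X $$ (c, d) * Y $$ (d, a)))"
    unfolding sum.distrib[symmetric] by (intro sum.cong refl) (simp add: G_def algebra_simps)
  also have "(\<Sum>a<N. \<Sum>b<N. \<Sum>c<N. \<Sum>d<N. X $$ (a, b) * Y $$ (b, a) * (X $$ (c, d) * Y $$ (d, c))) =
      (mat_trace (X * Y))\<^sup>2"
    unfolding mat_trace_mult[OF X Yc] power2_eq_square
    by (simp only: sum_distrib_left[symmetric] sum_distrib_right[symmetric])
  also have "(\<Sum>a<N. \<Sum>b<N. \<Sum>c<N. \<Sum>d<N. X $$ (a, b) * Y $$ (b, c) * (X $$ (c, d) * Y $$ (d, a))) =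
      (\<Sum>a<N. \<Sum>c<N. \<Sum>b<N. \<Sum>d<N. X $$ (a, b) * Y $$ (b, c) * (X $$ (c, d) * Y $$ (d, a)))"
    by (rule sum.cong[OF refl], rule sum.swap)
  also have "\<dots> = (\<Sum>a<N. \<Sum>c<N. (X * Y) $$ (a, c) * (X * Y) $$ (c, a))"
    using X Yc by (intro sum.cong refl) (simp add: scalar_prod_def lessThan_atLeast0 sum_product)
  also have "\<dots> = mat_trace ((X * Y) * (X * Y))"
    using X Yc by (subst mat_trace_mult[of _ N N]) auto
  finally show ?thesis .
qed

text \<open>The hypothesis says that the weighted sum of the tensors
  \<^term>\<open>sym_square (X i)\<close> has norm zero; contracting this vanishing tensor with \<^term>\<open>v\<close> gives the claim.\<close>

lemma sym_square_sum_eq_0: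
  fixes w :: "'i \<Rightarrow> real"
  assumes fin: "finite I" and X: "\<And>i. i \<in> I \<Longrightarrow> hermitian_mat N (X i)"
    and zero: "(\<Sum>i\<in>I. \<Sum>j\<in>I. complex_of_real (w i) * complex_of_real (w j) *
      ((mat_trace (X i * X j))\<^sup>2 + mat_trace ((X i * X j) * (X i * X j)))) = 0"
    and v: "v \<in> carrier_vec N"
  shows "(\<Sum>i\<in>I. complex_of_real (w i) * ((X i *\<^sub>v v) \<bullet>c v)\<^sup>2) = 0"
proof -
  let ?Q = "{..<N} \<times> {..<N} \<times> {..<N} \<times> {..<N}"
  define D where "D q = (\<Sum>i\<in>I. complex_of_real (w i) * sym_square (X i) q)" for q
  have "(\<Sum>q\<in>?Q. D q * cnj (D q)) =
    (\<Sum>q\<in>?Q. \<Sum>i\<in>I. \<Sum>j\<in>I. complex_of_real (w i) * complex_of_real (w j) *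
      (sym_square (X i) q * cnj (sym_square (X j) q)))"
    by (simp add: D_def sum_product mult_ac)
  also have "\<dots> = (\<Sum>i\<in>I. \<Sum>j\<in>I. complex_of_real (w i) * complex_of_real (w j) *
      (\<Sum>q\<in>?Q. sym_square (X i) q * cnj (sym_square (X j) q)))"
    by (subst sum.swap, intro sum.cong refl, subst sum.swap, simp add: sum_distrib_left)
  also have "\<dots> = (\<Sum>i\<in>I. \<Sum>j\<in>I. 2 * (complex_of_real (w i) * complex_of_real (w j) *
      ((mat_trace (X i * X j))\<^sup>2 + mat_trace ((X i * X j) * (X i * X j)))))"
    by (intro sum.cong refl) (simp only: sym_square_inner[OF hermitian_mat_carrier X] X mult_ac)
  also have "\<dots> = 0"
    using zero by (simp only: sum_distrib_left[symmetric] mult_zero_right)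
  finally have "complex_of_real (\<Sum>q\<in>?Q. (cmod (D q))\<^sup>2) = 0"
    by (simp only: of_real_sum complex_norm_square)
  then have D: "D q = 0" if "q \<in> ?Q" for q
    using that by (simp only: of_real_eq_0_iff) (subst (asm) sum_nonneg_eq_0_iff, auto)
  let ?v = "\<lambda>(a, b, c, d). (v $ b * cnj (v $ a)) * (v $ d * cnj (v $ c))"
  \<comment> \<open>The weight \<open>?v\<close> is symmetric under exchanging \<open>b\<close> and
    \<open>d\<close>, so both terms of \<open>sym_square\<close> contribute the same square.\<close>
  have contract: "(\<Sum>q\<in>?Q. sym_square Y q * ?v q) = 2 * ((Y *\<^sub>v v) \<bullet>c v)\<^sup>2"
    if Y: "Y \<in> carrier_mat N N" for Y
  proof -
    let ?t = "\<lambda>a b. Y $$ (a, b) * v $ b * cnj (v $ a)"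
    have "(\<Sum>q\<in>?Q. sym_square Y q * ?v q) =
      (\<Sum>a<N. \<Sum>b<N. \<Sum>c<N. \<Sum>d<N. sym_square Y (a, b, c, d) * ?v (a, b, c, d))"
      by (simp add: sum.cartesian_product split_def)
    also have "\<dots> = (\<Sum>a<N. \<Sum>b<N. \<Sum>c<N. \<Sum>d<N. ?t a b * ?t c d) + (\<Sum>a<N. \<Sum>b<N. \<Sum>c<N. \<Sum>d<N. ?t a d * ?t c b)"
      unfolding sum.distrib[symmetric]
      by (intro sum.cong refl) (simp add: sym_square_def algebra_simps)
    also have "(\<Sum>a<N. \<Sum>b<N. \<Sum>c<N. \<Sum>d<N. ?t a d * ?t c b) = (\<Sum>a<N. \<Sum>c<N. \<Sum>b<N. \<Sum>d<N. ?t c b * ?t a d)"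
      by (rule sum.cong[OF refl], subst sum.swap) (simp only: mult.commute)
    also have "\<dots> = ((Y *\<^sub>v v) \<bullet>c v)\<^sup>2"
      unfolding mat_trace_ketbra(2)[OF Y v] power2_eq_square
      by (simp only: sum_distrib_left[symmetric] sum_distrib_right[symmetric] mult.commute)
    also have "(\<Sum>a<N. \<Sum>b<N. \<Sum>c<N. \<Sum>d<N. ?t a b * ?t c d) = ((Y *\<^sub>v v) \<bullet>c v)\<^sup>2"
      unfolding mat_trace_ketbra(2)[OF Y v] power2_eq_square
      by (simp only: sum_distrib_left[symmetric] sum_distrib_right[symmetric])
    finally show ?thesis by simp
  qed
  have "0 = (\<Sum>q\<in>?Q. D q * ?v q)" using D by (simp add: sum.neutral)
  also have "\<dots> = (\<Sum>q\<in>?Q. \<Sum>i\<in>I. complex_of_real (w i) * (sym_square (X i) q * ?v q))"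
    by (simp add: D_def sum_distrib_right mult.assoc)
  also have "\<dots> = (\<Sum>i\<in>I. complex_of_real (w i) * (\<Sum>q\<in>?Q. sym_square (X i) q * ?v q))"
    by (subst sum.swap) (simp add: sum_distrib_left)
  also have "\<dots> = (\<Sum>i\<in>I. 2 * (complex_of_real (w i) * ((X i *\<^sub>v v) \<bullet>c v)\<^sup>2))"
    by (intro sum.cong refl, subst contract[OF hermitian_mat_carrier[OF X]]) simp_all
  finally show ?thesis by (simp only: sum_distrib_left[symmetric]) simp
qed

text \<open>Apply the previous lemma to all \<^term>\<open>P k x\<close> with weight one and to the identity (index
  \<^term>\<open>None\<close>) with weight \<open>- (N / M + 1)\<close>; the number \<^term>\<open>N + 1\<close> of measurements is exactly what
  makes the Gram sum vanish.\<close>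

lemma complementary_projections_design:
  fixes P :: "'k \<Rightarrow> 'x \<Rightarrow> complex mat"
  assumes K: "finite K" "card K = N + 1" and Om: "finite Om" "card Om = M" "M > 0"
    and herm: "\<And>k x. k \<in> K \<Longrightarrow> x \<in> Om \<Longrightarrow> hermitian_mat N (P k x)"
    and proj: "\<And>k x. k \<in> K \<Longrightarrow> x \<in> Om \<Longrightarrow> P k x * P k x = P k x"
    and orth: "\<And>k x y. k \<in> K \<Longrightarrow> x \<in> Om \<Longrightarrow> y \<in> Om \<Longrightarrow> x \<noteq> y \<Longrightarrow> P k x * P k y = 0\<^sub>m N N"
    and compl: "\<And>k l x y. k \<in> K \<Longrightarrow> l \<in> K \<Longrightarrow> k \<noteq> l \<Longrightarrow> x \<in> Om \<Longrightarrow> y \<in> Om \<Longrightarrow>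
      P k x * P l y * P k x = complex_of_real (1 / M) \<cdot>\<^sub>m P k x"
    and trace: "\<And>k x. k \<in> K \<Longrightarrow> x \<in> Om \<Longrightarrow> mat_trace (P k x) = complex_of_real (N / M)"
    and v: "v \<in> carrier_vec N"
  shows "(\<Sum>k\<in>K. \<Sum>x\<in>Om. ((P k x *\<^sub>v v) \<bullet>c v)\<^sup>2) = complex_of_real (N / M + 1) * (v \<bullet>c v)\<^sup>2"
proof -
  define r where "r = complex_of_real (N / M)"
  define \<tau> where "\<tau> X Y = (mat_trace (X * Y))\<^sup>2 + mat_trace ((X * Y) * (X * Y))" for X Y
  define X where "X i = (case i of None \<Rightarrow> 1\<^sub>m N | Some (k, x) \<Rightarrow> P k x)" for i
  define w where "w i = (case i of None \<Rightarrow> - (N / M + 1) | Some _ \<Rightarrow> 1)" for i :: "('k \<times> 'x) option"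
  let ?I = "insert None (Some ` (K \<times> Om))"
  have sumI: "(\<Sum>i\<in>?I. f i) = f None + (\<Sum>k\<in>K. \<Sum>x\<in>Om. f (Some (k, x)))" for f :: "_ \<Rightarrow> complex"
    using K Om by (simp add: sum.reindex sum.cartesian_product split_def)
  have r: "of_nat M * r = of_nat N" using Om by (simp add: r_def)
  note car = herm[THEN hermitian_mat_carrier]
  have \<tau>_same: "\<tau> (P k x) (P k y) = (if x = y then r\<^sup>2 + r else 0)" if "k \<in> K" "x \<in> Om" "y \<in> Om" for k x y
    using that by (auto simp: \<tau>_def proj orth trace r_def mat_trace_zero)
  have \<tau>_diff: "\<tau> (P k x) (P l y) = (r\<^sup>2 + r) / (of_nat M)\<^sup>2" if "k \<in> K" "l \<in> K" "k \<noteq> l" "x \<in> Om" "y \<in> Om" for k l x y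
  proof -
    note c = car[OF that(1,4)] car[OF that(2,5)]
    \<comment> \<open>Doubling the idempotent \<open>P k x\<close> and moving one copy cyclically
      creates the sandwich that \<open>compl\<close> evaluates.\<close>
    have "mat_trace (P k x * P l y) = mat_trace (P k x * (P k x * P l y))"
      using c proj[OF that(1,4)] by (simp add: assoc_mult_mat[of _ N N _ N _ N, symmetric])
    also have "\<dots> = mat_trace (P k x * P l y * P k x)"
      using c by (intro mat_trace_comm) auto
    finally have 1: "mat_trace (P k x * P l y) = r / of_nat M"
      unfolding compl[OF that] using that c by (simp add: mat_trace_smult[of _ N] trace r_def)
    have "(P k x * P l y) * (P k x * P l y) = (P k x * P l y * P k x) * P l y"
      using c by (simp add: assoc_mult_mat[of _ N N _ N _ N])
    also have "\<dots> = complex_of_real (1 / M) \<cdot>\<^sub>m (P k x * P l y)"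
      unfolding compl[OF that] using c by (intro mult_smult_assoc_mat) auto
    finally have "mat_trace ((P k x * P l y) * (P k x * P l y)) = r / (of_nat M)\<^sup>2"
      using c 1 by (simp add: mat_trace_smult[of _ N] power2_eq_square)
    with 1 show ?thesis by (simp add: \<tau>_def power_divide add_divide_distrib)
  qed
  have \<tau>_1: "\<tau> (1\<^sub>m N) (P k x) = r\<^sup>2 + r" "\<tau> (P k x) (1\<^sub>m N) = r\<^sup>2 + r" if "k \<in> K" "x \<in> Om" for k x
    using that car[OF that] by (auto simp: \<tau>_def proj trace r_def)
  have \<tau>_11: "\<tau> (1\<^sub>m N) (1\<^sub>m N) = (of_nat N)\<^sup>2 + of_nat N"
    by (simp add: \<tau>_def mat_trace_one)
  have "(\<Sum>l\<in>K. \<Sum>y\<in>Om. \<tau> (P k x) (P l y)) = (r\<^sup>2 + r) * (1 + r)" if kx: "k \<in> K" "x \<in> Om" for k x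
  proof -
    have "(\<Sum>l\<in>K. \<Sum>y\<in>Om. \<tau> (P k x) (P l y)) =
      (\<Sum>y\<in>Om. \<tau> (P k x) (P k y)) + (\<Sum>l\<in>K - {k}. \<Sum>y\<in>Om. \<tau> (P k x) (P l y))"
      using K kx by (simp add: sum.remove)
    also have "(\<Sum>y\<in>Om. \<tau> (P k x) (P k y)) = r\<^sup>2 + r"
      using kx Om by (simp add: \<tau>_same sum.delta)
    also have "(\<Sum>l\<in>K - {k}. \<Sum>y\<in>Om. \<tau> (P k x) (P l y)) = (\<Sum>l\<in>K - {k}. \<Sum>y\<in>Om. (r\<^sup>2 + r) / (of_nat M)\<^sup>2)"
      using kx by (intro sum.cong refl \<tau>_diff) auto
    \<comment> \<open>There are \<open>card K - 1 = N\<close> other measurements with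
      \<open>M\<close> outcomes each, and \<open>N * M / M^2 = r\<close>.\<close>
    also have "\<dots> = (r\<^sup>2 + r) * r"
      using K Om kx by (simp add: r[symmetric] power2_eq_square)
    finally show ?thesis by (simp add: algebra_simps)
  qed
  then have PP: "(\<Sum>k\<in>K. \<Sum>x\<in>Om. \<Sum>l\<in>K. \<Sum>y\<in>Om. \<tau> (P k x) (P l y)) = of_nat (N + 1) * of_nat M * ((r\<^sup>2 + r) * (1 + r))"
    using K Om by simp
  have "(\<Sum>i\<in>?I. \<Sum>j\<in>?I. complex_of_real (w i) * complex_of_real (w j) * \<tau> (X i) (X j)) = 0"
  proof -
    let ?T = "\<Sum>k\<in>K. \<Sum>x\<in>Om. r\<^sup>2 + r"
    define c where "c = r + 1"
    have wX: "complex_of_real (w None) = - c" "w (Some kx) = 1" "X None = 1\<^sub>m N"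
      "X (Some (k, x)) = P k x" for k x kx
      by (simp_all add: w_def X_def c_def r_def)
    have "(\<Sum>i\<in>?I. \<Sum>j\<in>?I. complex_of_real (w i) * complex_of_real (w j) * \<tau> (X i) (X j)) =
      c\<^sup>2 * \<tau> (1\<^sub>m N) (1\<^sub>m N) - c * (\<Sum>k\<in>K. \<Sum>x\<in>Om. \<tau> (1\<^sub>m N) (P k x)) -
      c * (\<Sum>k\<in>K. \<Sum>x\<in>Om. \<tau> (P k x) (1\<^sub>m N)) + (\<Sum>k\<in>K. \<Sum>x\<in>Om. \<Sum>l\<in>K. \<Sum>y\<in>Om. \<tau> (P k x) (P l y))"
      unfolding sumI wX
      by (simp add: sum.distrib sum_subtractf sum_distrib_left[symmetric] sum_negf power2_eq_square algebra_simps)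
    also have "(\<Sum>k\<in>K. \<Sum>x\<in>Om. \<tau> (1\<^sub>m N) (P k x)) = ?T"
      by (intro sum.cong refl \<tau>_1)
    also have "(\<Sum>k\<in>K. \<Sum>x\<in>Om. \<tau> (P k x) (1\<^sub>m N)) = ?T"
      by (intro sum.cong refl \<tau>_1)
    also have "?T = of_nat (N + 1) * of_nat M * (r\<^sup>2 + r)"
      using K Om by simp
    \<comment> \<open>As \<open>N = M * r\<close> and \<open>c = r + 1\<close>, the four terms are
      \<open>1\<close>, \<open>-1\<close>, \<open>-1\<close> and \<open>1\<close> times the common
      value \<open>(N + 1) * M * r * (r + 1)^2\<close>.\<close>
    finally show ?thesis
      unfolding PP \<tau>_11 r[symmetric] of_nat_add of_nat_1 c_def
      by (simp add: power2_eq_square algebra_simps)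
  qed
  then have "(\<Sum>i\<in>?I. complex_of_real (w i) * ((X i *\<^sub>v v) \<bullet>c v)\<^sup>2) = 0"
    using K Om herm v unfolding \<tau>_def
    by (intro sym_square_sum_eq_0) (auto simp: X_def hermitian_one)
  then have *: "- complex_of_real (N / M + 1) * (v \<bullet>c v)\<^sup>2 + (\<Sum>k\<in>K. \<Sum>x\<in>Om. ((P k x *\<^sub>v v) \<bullet>c v)\<^sup>2) = 0"
    unfolding sumI using v by (simp add: X_def w_def)
  have "S = a * q" if "- a * q + S = 0" for a q S :: complex
  proof -
    have "S = (- a * q + S) + a * q" by simp
    then show ?thesis using that by simp
  qed
  from this[OF *] show ?thesis .
qed

subsection \<open>Joint eigenprojections of commuting involutions\<close>

lemma hermitian_mult:
  assumes X: "hermitian_mat N X" and Y: "hermitian_mat N Y" and XY: "X * Y = Y * X"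
  shows "hermitian_mat N (X * Y)"
  unfolding hermitian_mat_def
proof (intro conjI allI impI)
  note c = X[THEN hermitian_mat_carrier] Y[THEN hermitian_mat_carrier]
  then show "X * Y \<in> carrier_mat N N" by auto
  fix i j assume ij: "i < N" "j < N"
  have "(X * Y) $$ (j, i) = (\<Sum>k<N. X $$ (j, k) * Y $$ (k, i))"
    using c ij by (simp add: scalar_prod_def lessThan_atLeast0)
  also have "\<dots> = (\<Sum>k<N. cnj (Y $$ (i, k) * X $$ (k, j)))"
  proof (rule sum.cong[OF refl])
    fix k assume "k \<in> {..<N}"
    then have "X $$ (j, k) = cnj (X $$ (k, j))" "Y $$ (k, i) = cnj (Y $$ (i, k))"
      using hermitian_mat_entry[OF X, of k j] hermitian_mat_entry[OF Y, of i k] ij by blast+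
    then show "X $$ (j, k) * Y $$ (k, i) = cnj (Y $$ (i, k) * X $$ (k, j))"
      by (simp only: complex_cnj_mult mult.commute)
  qed
  also have "\<dots> = cnj ((Y * X) $$ (i, j))"
    using c ij by (simp add: scalar_prod_def lessThan_atLeast0)
  finally show "(X * Y) $$ (j, i) = cnj ((X * Y) $$ (i, j))" by (simp only: XY)
qed

lemma hermitian_inner:
  assumes X: "hermitian_mat N X" and v: "v \<in> carrier_vec N" "w \<in> carrier_vec N"
  shows "(X *\<^sub>v v) \<bullet>c w = v \<bullet>c (X *\<^sub>v w)"
proof -
  note c = X[THEN hermitian_mat_carrier]
  have "(X *\<^sub>v v) \<bullet>c w = (\<Sum>a<N. \<Sum>b<N. X $$ (a, b) * v $ b * cnj (w $ a))"
    using c v by (simp add: scalar_prod_def lessThan_atLeast0 sum_distrib_right)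
  also have "\<dots> = (\<Sum>b<N. \<Sum>a<N. X $$ (a, b) * v $ b * cnj (w $ a))"
    by (rule sum.swap)
  also have "\<dots> = (\<Sum>b<N. \<Sum>a<N. v $ b * (cnj (X $$ (b, a)) * cnj (w $ a)))"
  proof (intro sum.cong refl)
    fix a b assume "b \<in> {..<N}" "a \<in> {..<N}"
    then have "X $$ (a, b) = cnj (X $$ (b, a))" using hermitian_mat_entry[OF X, of b a] by blast
    then show "X $$ (a, b) * v $ b * cnj (w $ a) = v $ b * (cnj (X $$ (b, a)) * cnj (w $ a))"
      by (simp only: mult_ac)
  qed
  also have "\<dots> = v \<bullet>c (X *\<^sub>v w)"
    using c v by (simp add: scalar_prod_def lessThan_atLeast0 sum_distrib_left)
  finally show ?thesis .
qed

text \<open>Complex polarization: unit vectors kill the diagonal. At \<open>e_i + s * e_j\<close>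
  there remains \<open>X_ij * s + X_ji * cnj s = 0\<close>, and the choices \<open>s = 1\<close> and
  \<open>s = \<i>\<close> separate the two entries.\<close>

lemma eq_0_if_quadratic_form_0:
  assumes X: "X \<in> carrier_mat N N"
    and zero: "\<And>v. v \<in> carrier_vec N \<Longrightarrow> (X *\<^sub>v v) \<bullet>c v = (0 :: complex)"
  shows "X = 0\<^sub>m N N"
proof (rule eq_matI)
  fix i j assume "i < dim_row (0\<^sub>m N N :: complex mat)" "j < dim_col (0\<^sub>m N N :: complex mat)"
  then have i: "i < N" and j: "j < N" by auto
  have diag: "X $$ (k, k) = 0" if "k < N" for k
    using zero[of "unit_vec N k"] X that by (simp add: scalar_prod_def sum.delta' if_distrib cong: if_cong)
  have mix: "X $$ (i, j) * s + X $$ (j, i) * cnj s = 0" if "i \<noteq> j" for s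
  proof -
    let ?v = "unit_vec N i + s \<cdot>\<^sub>v unit_vec N j"
    have v: "?v \<in> carrier_vec N" by auto
    have 1: "(\<Sum>b<N. f b * ?v $ b) = f i + f j * s" for f
    proof -
      have "(\<Sum>b<N. f b * ?v $ b) = (\<Sum>b<N. (if b = i then f b else 0) + (if b = j then f b * s else 0))"
        using i j by (intro sum.cong refl) (use that in auto)
      then show ?thesis using i j by (simp add: sum.distrib)
    qed
    have 2: "(\<Sum>a<N. f a * cnj (?v $ a)) = f i + f j * cnj s" for f
    proof -
      have "(\<Sum>b<N. f b * cnj (?v $ b)) = (\<Sum>b<N. (if b = i then f b else 0) + (if b = j then f b * cnj s else 0))"
        using i j by (intro sum.cong refl) (use that in auto)
      then show ?thesis using i j by (simp add: sum.distrib)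
    qed
    have "0 = (\<Sum>a<N. (\<Sum>b<N. X $$ (a, b) * ?v $ b) * cnj (?v $ a))"
      using zero[OF v] unfolding mat_trace_ketbra(2)[OF X v] by (simp only: sum_distrib_right)
    then show ?thesis
      unfolding 1 2 using diag[OF i] diag[OF j] by simp
  qed
  show "X $$ (i, j) = 0\<^sub>m N N $$ (i, j)"
  proof (cases "i = j")
    case False
    from mix[OF False, of 1] mix[OF False, of \<i>] have "X $$ (i, j) = 0"
      by (simp add: complex_eq_iff)
    then show ?thesis using i j by simp
  qed (use diag i in simp)
qed (use X in auto)

lemma mult_mat_regroup:
  assumes "A \<in> carrier_mat N N" "B \<in> carrier_mat N N" "C \<in> carrier_mat N N" "D \<in> carrier_mat N N"
  shows "(A * B) * (C * D) = A * (B * C) * D"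
  using assms by (simp add: assoc_mult_mat[of _ N N _ N _ N])

lemma smult_mult_smult:
  fixes a b :: complex
  assumes "A \<in> carrier_mat N N" "B \<in> carrier_mat N N"
  shows "(a \<cdot>\<^sub>m A) * (b \<cdot>\<^sub>m B) = (a * b) \<cdot>\<^sub>m (A * B)"
proof -
  have "(a \<cdot>\<^sub>m A) * (b \<cdot>\<^sub>m B) = a \<cdot>\<^sub>m (b \<cdot>\<^sub>m (A * B))"
    using assms mult_smult_assoc_mat[of A N N "b \<cdot>\<^sub>m B" N a] mult_smult_distrib[of A N N B N b] by simp
  also have "\<dots> = (a * b) \<cdot>\<^sub>m (A * B)"
    by (auto intro!: eq_matI)
  finally show ?thesis .
qed

definition eigenprojection :: "nat \<Rightarrow> complex mat \<Rightarrow> int \<Rightarrow> complex mat" where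
  "eigenprojection N P s = (1 / 2) \<cdot>\<^sub>m (1\<^sub>m N + ((- 1) powi s) \<cdot>\<^sub>m P)"

text \<open>The prefix length \<open>L\<close> is a separate parameter to allow induction on it;
  \<open>joint_projector\<close> is the case of the full list.\<close>

definition joint_eigenprojection :: "nat \<Rightarrow> complex mat list \<Rightarrow> nat \<Rightarrow> (nat \<Rightarrow> int) \<Rightarrow> complex mat" where
  "joint_eigenprojection N Ps L x = foldr (\<lambda>k M. eigenprojection N (Ps ! k) (x k) * M) [0..<L] (1\<^sub>m N)"

lemma joint_projector_eq:
  "joint_projector n A x = joint_eigenprojection (2 ^ n) (pauli_gens n A) (length (pauli_gens n A)) x"
  by (simp add: joint_projector_def joint_eigenprojection_def eigenprojection_def)

lemma eigenprojection_carrier: "P \<in> carrier_mat N N \<Longrightarrow> eigenprojection N P s \<in> carrier_mat N N"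
  by (simp add: eigenprojection_def)

lemma hermitian_eigenprojection:
  assumes P: "hermitian_mat N P"
  shows "hermitian_mat N (eigenprojection N P s)"
  unfolding hermitian_mat_def
proof (intro conjI allI impI)
  show "eigenprojection N P s \<in> carrier_mat N N"
    by (intro eigenprojection_carrier hermitian_mat_carrier[OF P])
  fix i j assume ij: "i < N" "j < N"
  have "cnj ((- 1) powi s) = (- 1) powi s" by (simp add: power_int_def)
  then show "eigenprojection N P s $$ (j, i) = cnj (eigenprojection N P s $$ (i, j))"
    using ij hermitian_mat_carrier[OF P] hermitian_mat_entry[OF P ij]
    by (auto simp add: eigenprojection_def)
qed

lemma eigenprojection_mult:
  assumes P: "P \<in> carrier_mat N N" and Q: "Q \<in> carrier_mat N N"
  shows "eigenprojection N P s * eigenprojection N Q t =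
    (1 / 4) \<cdot>\<^sub>m (1\<^sub>m N + ((- 1) powi s) \<cdot>\<^sub>m P + ((- 1) powi t) \<cdot>\<^sub>m Q + ((- 1) powi s * (- 1) powi t) \<cdot>\<^sub>m (P * Q))"
proof -
  let ?a = "(- 1) powi s :: complex" and ?b = "(- 1) powi t :: complex"
  have "(1\<^sub>m N + ?a \<cdot>\<^sub>m P) * (1\<^sub>m N + ?b \<cdot>\<^sub>m Q) = 1\<^sub>m N * (1\<^sub>m N + ?b \<cdot>\<^sub>m Q) + (?a \<cdot>\<^sub>m P) * (1\<^sub>m N + ?b \<cdot>\<^sub>m Q)"
    using P Q by (intro add_mult_distrib_mat) auto
  also have "(?a \<cdot>\<^sub>m P) * (1\<^sub>m N + ?b \<cdot>\<^sub>m Q) = (?a \<cdot>\<^sub>m P) * 1\<^sub>m N + (?a \<cdot>\<^sub>m P) * (?b \<cdot>\<^sub>m Q)"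
    using P Q by (intro mult_add_distrib_mat) auto
  also have "(?a \<cdot>\<^sub>m P) * (?b \<cdot>\<^sub>m Q) = (?a * ?b) \<cdot>\<^sub>m (P * Q)"
    by (rule smult_mult_smult[OF P Q])
  finally have *: "(1\<^sub>m N + ?a \<cdot>\<^sub>m P) * (1\<^sub>m N + ?b \<cdot>\<^sub>m Q) =
    1\<^sub>m N + ?a \<cdot>\<^sub>m P + ?b \<cdot>\<^sub>m Q + (?a * ?b) \<cdot>\<^sub>m (P * Q)"
    using P Q by (auto intro!: eq_matI simp: algebra_simps)
  have "eigenprojection N P s * eigenprojection N Q t = (1 / 4) \<cdot>\<^sub>m ((1\<^sub>m N + ?a \<cdot>\<^sub>m P) * (1\<^sub>m N + ?b \<cdot>\<^sub>m Q))"
    unfolding eigenprojection_def using P Q by (subst smult_mult_smult[of _ N]) auto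
  then show ?thesis unfolding * .
qed

lemma eigenprojection_orth:
  assumes P: "P \<in> carrier_mat N N" "P * P = 1\<^sub>m N" and st: "s \<in> {0, 1}" "t \<in> {0, 1}"
  shows "eigenprojection N P s * eigenprojection N P t = (if s = t then eigenprojection N P s else 0\<^sub>m N N)"
  using P st unfolding eigenprojection_mult[OF P(1,1)]
  by (auto intro!: eq_matI simp: eigenprojection_def)

lemma eigenprojection_sum:
  assumes P: "P \<in> carrier_mat N N"
  shows "eigenprojection N P 0 + eigenprojection N P 1 = 1\<^sub>m N"
  using P by (auto intro!: eq_matI simp: eigenprojection_def field_simps)

lemma eigenprojection_comm:
  assumes P: "P \<in> carrier_mat N N" "Q \<in> carrier_mat N N" "P * Q = Q * P"
  shows "eigenprojection N P s * eigenprojection N Q t = eigenprojection N Q t * eigenprojection N P s"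
  unfolding eigenprojection_mult[OF P(1,2)] eigenprojection_mult[OF P(2,1)] P(3)
  using P by (auto intro!: eq_matI)

lemma joint_eigenprojection_0: "joint_eigenprojection N Ps 0 x = 1\<^sub>m N"
  by (simp add: joint_eigenprojection_def)

lemma joint_eigenprojection_cong:
  "(\<And>k. k < L \<Longrightarrow> x k = y k) \<Longrightarrow> joint_eigenprojection N Ps L x = joint_eigenprojection N Ps L y"
  unfolding joint_eigenprojection_def by (intro foldr_cong) auto

context
  fixes N :: nat and Ps :: "complex mat list"
  assumes herm: "\<And>P. P \<in> set Ps \<Longrightarrow> hermitian_mat N P"
    and invol: "\<And>P. P \<in> set Ps \<Longrightarrow> P * P = 1\<^sub>m N"
    and comm: "\<And>P Q. P \<in> set Ps \<Longrightarrow> Q \<in> set Ps \<Longrightarrow> P * Q = Q * P"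
begin

lemma nth_hermitian_carrier: "k < length Ps \<Longrightarrow> Ps ! k \<in> carrier_mat N N"
  by (intro hermitian_mat_carrier herm nth_mem)

lemma joint_eigenprojection_Suc:
  assumes L: "Suc L \<le> length Ps"
  shows "joint_eigenprojection N Ps (Suc L) x =
    joint_eigenprojection N Ps L x * eigenprojection N (Ps ! L) (x L)"
    and "joint_eigenprojection N Ps L x \<in> carrier_mat N N"
proof -
  let ?f = "\<lambda>k M. eigenprojection N (Ps ! k) (x k) * M"
  \<comment> \<open>Going from \<open>[0..<L]\<close> to \<open>[0..<Suc L]\<close> adds a factor at
    the innermost place of the fold; this fact pulls it out as a right factor. The carrier claim is
    proved along with it because associativity depends on it.\<close>
  have *: "foldr ?f ks (1\<^sub>m N) \<in> carrier_mat N N \<and> foldr ?f ks M = foldr ?f ks (1\<^sub>m N) * M"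
    if "set ks \<subseteq> {..<length Ps}" "M \<in> carrier_mat N N" for ks M
    using that
  proof (induction ks)
    case (Cons k ks)
    then have "eigenprojection N (Ps ! k) (x k) \<in> carrier_mat N N"
      by (intro eigenprojection_carrier nth_hermitian_carrier) auto
    with Cons show ?case by (simp add: assoc_mult_mat[of _ N N _ N _ N])
  qed simp
  have c: "eigenprojection N (Ps ! L) (x L) \<in> carrier_mat N N"
    using L by (intro eigenprojection_carrier nth_hermitian_carrier) auto
  have sub: "set [0..<L] \<subseteq> {..<length Ps}" using L by auto
  show "joint_eigenprojection N Ps L x \<in> carrier_mat N N"
    using *[OF sub, of "1\<^sub>m N"] by (auto simp: joint_eigenprojection_def)
  show "joint_eigenprojection N Ps (Suc L) x =
    joint_eigenprojection N Ps L x * eigenprojection N (Ps ! L) (x L)"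
    using *[OF sub c] c by (simp add: joint_eigenprojection_def)
qed

text \<open>The product of Hermitian matrices is Hermitian when they commute, so the induction
  carries along commutation with every single eigenprojection of the list.\<close>

lemma joint_eigenprojection_hermitian:
  assumes "L \<le> length Ps"
  shows "hermitian_mat N (joint_eigenprojection N Ps L x) \<and>
    (\<forall>k<length Ps. joint_eigenprojection N Ps L x * eigenprojection N (Ps ! k) t =
      eigenprojection N (Ps ! k) t * joint_eigenprojection N Ps L x)"
  using assms
proof (induction L arbitrary: t)
  case 0
  have "1\<^sub>m N * eigenprojection N (Ps ! k) t = eigenprojection N (Ps ! k) t * 1\<^sub>m N" if "k < length Ps" for k
    using eigenprojection_carrier[OF nth_hermitian_carrier[OF that], of t] by simp
  then show ?case by (simp add: joint_eigenprojection_0 hermitian_one)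
next
  case (Suc L)
  let ?J = "joint_eigenprojection N Ps L x" and ?E = "eigenprojection N (Ps ! L) (x L)"
  have J: "hermitian_mat N ?J" "\<And>k t. k < length Ps \<Longrightarrow> ?J * eigenprojection N (Ps ! k) t = eigenprojection N (Ps ! k) t * ?J"
    using Suc by auto
  have E: "hermitian_mat N ?E" using Suc.prems by (intro hermitian_eigenprojection herm nth_mem) auto
  have "?J * ?E * eigenprojection N (Ps ! k) t = eigenprojection N (Ps ! k) t * (?J * ?E)" if k: "k < length Ps" for k
  proof -
    let ?F = "eigenprojection N (Ps ! k) t"
    have F: "?F \<in> carrier_mat N N" using k by (intro eigenprojection_carrier nth_hermitian_carrier)
    note c = F J(1)[THEN hermitian_mat_carrier] E[THEN hermitian_mat_carrier]
    have "?J * ?E * ?F = ?J * (?E * ?F)" using c by simp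
    also have "?E * ?F = ?F * ?E"
      using k Suc.prems by (intro eigenprojection_comm nth_hermitian_carrier comm nth_mem) auto
    also have "?J * (?F * ?E) = ?J * ?F * ?E" using c by simp
    also have "?J * ?F = ?F * ?J" by (rule J(2)[OF k])
    also have "?F * ?J * ?E = ?F * (?J * ?E)" using c by simp
    finally show ?thesis .
  qed
  then show ?case
    unfolding joint_eigenprojection_Suc[OF Suc.prems]
    using hermitian_mult[OF J(1) E] J(2)[of L] Suc.prems by auto
qed

lemma joint_eigenprojection_orth:
  assumes "L \<le> length Ps" and "\<And>k. k < L \<Longrightarrow> x k \<in> {0, 1} \<and> y k \<in> {0, 1}"
  shows "joint_eigenprojection N Ps L x * joint_eigenprojection N Ps L y =
    (if \<forall>k<L. x k = y k then joint_eigenprojection N Ps L x else 0\<^sub>m N N)"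
  using assms
proof (induction L)
  case (Suc L)
  let ?J = "joint_eigenprojection N Ps L" and ?E = "eigenprojection N (Ps ! L)"
  have J: "?J z \<in> carrier_mat N N" for z using joint_eigenprojection_Suc(2)[OF Suc.prems(1)] .
  have E: "?E t \<in> carrier_mat N N" for t
    using Suc.prems by (intro eigenprojection_carrier nth_hermitian_carrier) auto
  have "(?J x * ?E (x L)) * (?J y * ?E (y L)) = ?J x * (?E (x L) * ?J y) * ?E (y L)"
    by (rule mult_mat_regroup[OF J E J E])
  \<comment> \<open>Commuting the inner factors pairs the two prefixes, handled by induction, and
    the two last eigenprojections.\<close>
  also have "?E (x L) * ?J y = ?J y * ?E (x L)"
    using joint_eigenprojection_hermitian[of L y] Suc.prems by auto
  also have "?J x * (?J y * ?E (x L)) * ?E (y L) = (?J x * ?J y) * (?E (x L) * ?E (y L))"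
    by (rule mult_mat_regroup[OF J J E E, symmetric])
  also have "?J x * ?J y = (if \<forall>k<L. x k = y k then ?J x else 0\<^sub>m N N)"
    using Suc by auto
  also have "?E (x L) * ?E (y L) = (if x L = y L then ?E (x L) else 0\<^sub>m N N)"
    using Suc.prems by (intro eigenprojection_orth nth_hermitian_carrier invol nth_mem) auto
  finally show ?case
    unfolding joint_eigenprojection_Suc(1)[OF Suc.prems(1)]
    using J[of x] E[of "x L"] E[of "y L"] by (auto simp: less_Suc_eq)
qed (simp add: joint_eigenprojection_0)

text \<open>Resolution of the identity, tested against \<open>M\<close>. In this weak form the last
  eigenprojection is absorbed into the arbitrary \<open>M\<close>, and its two signs add up to the
  identity.\<close>

lemma joint_eigenprojection_sum:
  assumes "L \<le> length Ps" and "M \<in> carrier_mat N N"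
  shows "(\<Sum>x\<in>{..<L} \<rightarrow>\<^sub>E {0, 1}. mat_trace (joint_eigenprojection N Ps L x * M)) = mat_trace M"
  using assms
proof (induction L arbitrary: M)
  case (Suc L)
  let ?J = "joint_eigenprojection N Ps L" and ?E = "eigenprojection N (Ps ! L)"
  have J: "?J z \<in> carrier_mat N N" for z using joint_eigenprojection_Suc(2)[OF Suc.prems(1)] .
  have E: "?E t \<in> carrier_mat N N" for t
    using Suc.prems by (intro eigenprojection_carrier nth_hermitian_carrier) auto
  note M = Suc.prems(2)
  have dom: "{..<Suc L} \<rightarrow>\<^sub>E {0, 1} = (\<lambda>(s, g). g(L := s)) ` ({0, 1 :: int} \<times> ({..<L} \<rightarrow>\<^sub>E {0, 1}))"
    by (simp add: lessThan_Suc PiE_insert_eq)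
  have "(\<Sum>x\<in>{..<Suc L} \<rightarrow>\<^sub>E {0, 1}. mat_trace (joint_eigenprojection N Ps (Suc L) x * M)) =
    (\<Sum>(s, g)\<in>{0, 1} \<times> ({..<L} \<rightarrow>\<^sub>E {0, 1}). mat_trace (joint_eigenprojection N Ps (Suc L) (g(L := s)) * M))"
    unfolding dom using inj_combinator[of L "{..<L}" "\<lambda>_. {0, 1 :: int}"]
    by (subst sum.reindex) (auto simp: split_def)
  also have "\<dots> = (\<Sum>(s, g)\<in>{0, 1} \<times> ({..<L} \<rightarrow>\<^sub>E {0, 1}). mat_trace (?J g * (?E s * M)))"
  proof (intro sum.cong refl, clarify)
    fix s g
    have "?J (g(L := s)) = ?J g" by (intro joint_eigenprojection_cong) auto
    then show "mat_trace (joint_eigenprojection N Ps (Suc L) (g(L := s)) * M) = mat_trace (?J g * (?E s * M))"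
      unfolding joint_eigenprojection_Suc(1)[OF Suc.prems(1)]
      using J[of g] E[of s] M by (simp add: assoc_mult_mat[of _ N N _ N _ N])
  qed
  also have "\<dots> = (\<Sum>s\<in>{0, 1}. \<Sum>g\<in>{..<L} \<rightarrow>\<^sub>E {0, 1}. mat_trace (?J g * (?E s * M)))"
    by (rule sum.cartesian_product[symmetric])
  also have "\<dots> = (\<Sum>s\<in>{0, 1}. mat_trace (?E s * M))"
    using Suc.prems by (intro sum.cong refl Suc.IH mult_carrier_mat[OF E]) auto
  also have "\<dots> = mat_trace ((?E 0 + ?E 1) * M)"
    using E[of 0] E[of 1] M by (simp add: add_mult_distrib_mat[of _ N N] mat_trace_add[of _ N])
  also have "?E 0 + ?E 1 = 1\<^sub>m N"
    using Suc.prems by (intro eigenprojection_sum nth_hermitian_carrier) auto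
  finally show ?case using M by simp
qed (simp add: joint_eigenprojection_0)

end

subsection \<open>Complementary Pauli measurements\<close>

lemma outcomes_eq:
  assumes "abelian_pauli_subgroup n A" "has_pauli_dim n A m"
  shows "outcomes n A = {..<m} \<rightarrow>\<^sub>E {0, 1}"
  by (simp add: outcomes_def pauli_gens_subset_length(2)[OF assms] carrier_Z2_power)

text \<open>The chosen generators lie in \<open>A\<close>, so the facts on commuting Hermitian
  involutions apply. Outcomes are extensional functions, hence agreement below \<open>m\<close> is
  equality.\<close>

lemma joint_projector_measurement:
  assumes A: "abelian_pauli_subgroup n A" "has_pauli_dim n A m"
  shows "hermitian_mat (2 ^ n) (joint_projector n A x)"
    and "x \<in> {..<m} \<rightarrow>\<^sub>E {0, 1} \<Longrightarrow> y \<in> {..<m} \<rightarrow>\<^sub>E {0, 1} \<Longrightarrow>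
      joint_projector n A x * joint_projector n A y =
        (if x = y then joint_projector n A x else 0\<^sub>m (2 ^ n) (2 ^ n))"
    and "M \<in> carrier_mat (2 ^ n) (2 ^ n) \<Longrightarrow>
      (\<Sum>x\<in>{..<m} \<rightarrow>\<^sub>E {0, 1}. mat_trace (joint_projector n A x * M)) = mat_trace M"
proof -
  note gens = pauli_gens_subset_length[OF A]
  have herm: "P \<in> set (pauli_gens n A) \<Longrightarrow> hermitian_mat (2 ^ n) P"
    and invol: "P \<in> set (pauli_gens n A) \<Longrightarrow> P * P = 1\<^sub>m (2 ^ n)" for P
    using abelian_pauli_subgroup_elem[OF A(1)] gens by auto
  have comm: "P * Q = Q * P" if "P \<in> set (pauli_gens n A)" "Q \<in> set (pauli_gens n A)" for P Q
    using that gens A(1) by (auto simp: abelian_pauli_subgroup_def)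
  note eq = joint_projector_eq[of n A, unfolded gens(2)]
  have le: "m \<le> length (pauli_gens n A)" by (simp add: gens)
  show "hermitian_mat (2 ^ n) (joint_projector n A x)"
    unfolding eq using joint_eigenprojection_hermitian[OF herm invol comm le] by blast
  show "M \<in> carrier_mat (2 ^ n) (2 ^ n) \<Longrightarrow>
      (\<Sum>x\<in>{..<m} \<rightarrow>\<^sub>E {0, 1}. mat_trace (joint_projector n A x * M)) = mat_trace M"
    unfolding eq by (rule joint_eigenprojection_sum[OF herm invol comm le])
  assume xy: "x \<in> {..<m} \<rightarrow>\<^sub>E {0, 1}" "y \<in> {..<m} \<rightarrow>\<^sub>E {0, 1}"
  have "joint_projector n A x * joint_projector n A y =
    (if \<forall>k<m. x k = y k then joint_projector n A x else 0\<^sub>m (2 ^ n) (2 ^ n))"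
    unfolding eq using xy by (intro joint_eigenprojection_orth[OF herm invol comm le]) auto
  moreover have "(\<forall>k<m. x k = y k) \<longleftrightarrow> x = y"
    using xy by (auto intro: PiE_ext)
  ultimately show "joint_projector n A x * joint_projector n A y =
    (if x = y then joint_projector n A x else 0\<^sub>m (2 ^ n) (2 ^ n))" by simp
qed

section \<open>From complementarity of states to operator identities\<close>

lemma cnj_inner: "v \<in> carrier_vec N \<Longrightarrow> w \<in> carrier_vec N \<Longrightarrow> cnj (v \<bullet>c w) = w \<bullet>c v"
  by (auto simp: scalar_prod_def mult.commute)

lemma density_operator_ketbra:
  assumes \<psi>: "pure_state n \<psi>"
  shows "density_operator n (ketbra \<psi>)"
proof -
  have c: "\<psi> \<in> carrier_vec (2 ^ n)" "\<psi> \<bullet>c \<psi> = 1" using \<psi> by (auto simp: pure_state_def)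
  then have k: "ketbra \<psi> \<in> carrier_mat (2 ^ n) (2 ^ n)" by (auto simp: ketbra_def)
  have "mat_adjoint (ketbra \<psi>) = ketbra \<psi>"
    using c by (intro eq_matI) (auto simp: mat_adjoint_def ketbra_def mat_of_rows_def mult.commute)
  moreover have "0 \<le> (ketbra \<psi> *\<^sub>v v) \<bullet>c v" if v: "v \<in> carrier_vec (2 ^ n)" for v
  proof -
    have "(ketbra \<psi> *\<^sub>v v) \<bullet>c v = (\<Sum>a<2 ^ n. \<Sum>b<2 ^ n. (\<psi> $ a * cnj (v $ a)) * (v $ b * cnj (\<psi> $ b)))"
      unfolding mat_trace_ketbra(2)[OF k v] using c by (intro sum.cong refl) (auto simp: ketbra_def)
    also have "\<dots> = (\<psi> \<bullet>c v) * (v \<bullet>c \<psi>)"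
      using c v by (simp add: scalar_prod_def lessThan_atLeast0 sum_product)
    also have "\<dots> = complex_of_real ((cmod (\<psi> \<bullet>c v))\<^sup>2)"
      unfolding cnj_inner[OF c(1) v, symmetric] by (simp only: complex_norm_square)
    finally show ?thesis by (simp add: less_eq_complex_def del: of_real_power)
  qed
  moreover have "mat_trace (ketbra \<psi>) = 1"
    using c by (simp add: mat_trace_def ketbra_def scalar_prod_def lessThan_atLeast0)
  ultimately show ?thesis using k by (simp add: density_operator_def)
qed

text \<open>\<open>outcome_prob\<close> is defined through \<open>Re\<close>; this fact shows that
  nothing is lost on returning to complex inner products.\<close>

lemma hermitian_quadratic_form_real:
  assumes "hermitian_mat N X" "v \<in> carrier_vec N"
  shows "complex_of_real (Re ((X *\<^sub>v v) \<bullet>c v)) = (X *\<^sub>v v) \<bullet>c v"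
proof -
  have "X *\<^sub>v v \<in> carrier_vec N" using assms(2) hermitian_mat_carrier[OF assms(1)] by simp
  then have "cnj ((X *\<^sub>v v) \<bullet>c v) = (X *\<^sub>v v) \<bullet>c v"
    using cnj_inner[of "X *\<^sub>v v" N v] hermitian_inner[OF assms(1,2,2)] assms by simp
  then show ?thesis by (simp add: complex_eq_iff)
qed

lemma outcome_prob_ketbra:
  assumes A: "abelian_pauli_subgroup n A" "has_pauli_dim n A m" and v: "v \<in> carrier_vec (2 ^ n)"
  shows "complex_of_real (outcome_prob n A (ketbra v) x) = (joint_projector n A x *\<^sub>v v) \<bullet>c v"
  unfolding outcome_prob_def mat_trace_ketbra(1)[OF hermitian_mat_carrier[OF joint_projector_measurement(1)[OF A]] v]
  by (rule hermitian_quadratic_form_real[OF joint_projector_measurement(1)[OF A] v])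

lemma inner_self:
  assumes "v \<in> carrier_vec N"
  shows "v \<bullet>c v = complex_of_real (\<Sum>a<N. (cmod (v $ a))\<^sup>2)"
  using assms by (simp add: scalar_prod_def lessThan_atLeast0 complex_norm_square[symmetric] del: of_real_power)

text \<open>After normalization \<open>\<phi>\<close> has outcome \<open>x\<close> with certainty,
  so it is a state of maximal information in \<open>A\<close> and complementarity fixes its
  statistics in \<open>B\<close>. Both sides scale alike with the norm.\<close>

lemma complementary_unbiased:
  assumes A: "abelian_pauli_subgroup n A" "has_pauli_dim n A m"
    and B: "abelian_pauli_subgroup n B" "has_pauli_dim n B m"
    and compl: "complementary n A B"
    and x: "x \<in> {..<m} \<rightarrow>\<^sub>E {0, 1}" and y: "y \<in> {..<m} \<rightarrow>\<^sub>E {0, 1}"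
    and \<phi>: "\<phi> \<in> carrier_vec (2 ^ n)" "joint_projector n A x *\<^sub>v \<phi> = \<phi>"
  shows "(joint_projector n B y *\<^sub>v \<phi>) \<bullet>c \<phi> = complex_of_real (1 / 2 ^ m) * (\<phi> \<bullet>c \<phi>)"
\<comment> \<open>The zero vector cannot be normalized, but both sides vanish for it.\<close>
proof (cases "\<phi> \<bullet>c \<phi> = 0")
  case True
  then have "(\<Sum>a<2 ^ n. (cmod (\<phi> $ a))\<^sup>2) = 0"
    unfolding inner_self[OF \<phi>(1)] by (simp only: of_real_eq_0_iff)
  then have "\<forall>a<2 ^ n. \<phi> $ a = 0" by (subst (asm) sum_nonneg_eq_0_iff) auto
  then have "\<phi> = 0\<^sub>v (2 ^ n)" using \<phi> by (intro eq_vecI) auto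
  then show ?thesis
    using hermitian_mat_carrier[OF joint_projector_measurement(1)[OF B], of y] by simp
next
  case False
  let ?PA = "joint_projector n A" and ?PB = "joint_projector n B"
  note cA = hermitian_mat_carrier[OF joint_projector_measurement(1)[OF A]]
  note cB = hermitian_mat_carrier[OF joint_projector_measurement(1)[OF B]]
  define q where "q = (\<Sum>a<2 ^ n. (cmod (\<phi> $ a))\<^sup>2)"
  have q: "\<phi> \<bullet>c \<phi> = complex_of_real q" unfolding q_def by (rule inner_self[OF \<phi>(1)])
  have "q \<ge> 0" unfolding q_def by (rule sum_nonneg) simp
  with q False have "q > 0" by (cases "q = 0") auto
  define s where "s = complex_of_real (1 / sqrt q)"
  have s: "s * cnj s = complex_of_real (1 / q)"
    using \<open>q > 0\<close> by (simp add: s_def flip: of_real_mult)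
  define u where "u = s \<cdot>\<^sub>v \<phi>"
  have u: "u \<in> carrier_vec (2 ^ n)" using \<phi> by (simp add: u_def)
  have scale: "(X *\<^sub>v u) \<bullet>c u = complex_of_real (1 / q) * ((X *\<^sub>v \<phi>) \<bullet>c \<phi>)"
    if X: "X \<in> carrier_mat (2 ^ n) (2 ^ n)" for X
  proof -
    have "(X *\<^sub>v u) \<bullet>c u = (s * cnj s) * ((X *\<^sub>v \<phi>) \<bullet>c \<phi>)"
      unfolding mat_trace_ketbra(2)[OF X u] mat_trace_ketbra(2)[OF X \<phi>(1)]
      using \<phi> by (simp add: u_def sum_distrib_left mult_ac)
    then show ?thesis by (simp only: s)
  qed
  have "u \<bullet>c u = 1"
    using scale[of "1\<^sub>m (2 ^ n)"] u \<phi> q \<open>q > 0\<close> by simp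
  with u have pure: "pure_state n u" by (simp add: pure_state_def)
  have PAu: "?PA x *\<^sub>v u = u"
    unfolding u_def using \<phi> cA by (simp add: mult_mat_vec[of _ "2 ^ n" "2 ^ n"])
  have "outcome_prob n A (ketbra u) x' = (if x' = x then 1 else 0)" if x': "x' \<in> {..<m} \<rightarrow>\<^sub>E {0, 1}" for x'
  proof -
    \<comment> \<open>The projection for \<open>x\<close> fixes \<open>u\<close>, so it may be
      inserted, and orthogonality decides the outcome.\<close>
    have "?PA x' *\<^sub>v u = (?PA x' * ?PA x) *\<^sub>v u"
      using PAu cA u by (simp add: assoc_mult_mat_vec[of _ "2 ^ n" "2 ^ n" _ "2 ^ n"])
    also have "\<dots> = (if x' = x then u else 0\<^sub>v (2 ^ n))"
    proof -
      have "0\<^sub>m (2 ^ n) (2 ^ n) *\<^sub>v u = 0\<^sub>v (2 ^ n)"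
        using u by (intro eq_vecI) (auto simp: scalar_prod_def)
      then show ?thesis using PAu by (simp add: joint_projector_measurement(2)[OF A x' x])
    qed
    finally have "complex_of_real (outcome_prob n A (ketbra u) x') = (if x' = x then 1 else 0)"
      unfolding outcome_prob_ketbra[OF A u] using u \<open>u \<bullet>c u = 1\<close> by simp
    then show ?thesis by (simp split: if_splits)
  qed
  then have "max_information n A (ketbra u)"
    using x by (auto simp: max_information_def outcomes_eq[OF A])
  then have "unbiased n B (ketbra u)"
    using compl density_operator_ketbra[OF pure] by (simp add: complementary_def)
  then have "outcome_prob n B (ketbra u) y = 1 / 2 ^ m"
    using y by (simp add: unbiased_def outcomes_eq[OF B] pauli_gens_subset_length[OF B])
  then have "complex_of_real (1 / q) * ((?PB y *\<^sub>v \<phi>) \<bullet>c \<phi>) = complex_of_real (1 / 2 ^ m)"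
    unfolding scale[OF cB, symmetric] outcome_prob_ketbra[OF B u, symmetric] by simp
  then show ?thesis
    unfolding q using \<open>q > 0\<close> by (simp add: field_simps)
qed

lemma smult_mat_mult_vec:
  fixes X :: "complex mat"
  assumes "X \<in> carrier_mat N N" "v \<in> carrier_vec N"
  shows "(a \<cdot>\<^sub>m X) *\<^sub>v v = a \<cdot>\<^sub>v (X *\<^sub>v v)"
  using assms by (intro eq_vecI) auto

text \<open>The quadratic form of \<open>P * Q * P\<close> at \<open>v\<close> is that of
  \<open>Q\<close> at \<open>P v\<close>, a vector in the range of \<open>P\<close>. By unbiasedness
  it equals the form of \<open>P / M\<close> at \<open>v\<close>, and equal forms belong to equal
  matrices.\<close>

lemma complementary_compress:
  assumes A: "abelian_pauli_subgroup n A" "has_pauli_dim n A m"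
    and B: "abelian_pauli_subgroup n B" "has_pauli_dim n B m"
    and compl: "complementary n A B"
    and x: "x \<in> {..<m} \<rightarrow>\<^sub>E {0, 1}" and y: "y \<in> {..<m} \<rightarrow>\<^sub>E {0, 1}"
  shows "joint_projector n A x * joint_projector n B y * joint_projector n A x =
    complex_of_real (1 / 2 ^ m) \<cdot>\<^sub>m joint_projector n A x"
proof -
  let ?N = "2 ^ n :: nat"
  let ?P = "joint_projector n A x" and ?Q = "joint_projector n B y"
  let ?c = "complex_of_real (1 / 2 ^ m)"
  note hP = joint_projector_measurement(1)[OF A, of x]
  note P = hermitian_mat_carrier[OF hP]
  note Q = hermitian_mat_carrier[OF joint_projector_measurement(1)[OF B, of y]]
  have PP: "?P * ?P = ?P" using joint_projector_measurement(2)[OF A x x] by simp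
  let ?X = "?P * ?Q * ?P + (- ?c) \<cdot>\<^sub>m ?P"
  have "?X = 0\<^sub>m ?N ?N"
  proof (rule eq_0_if_quadratic_form_0)
    show "?X \<in> carrier_mat ?N ?N" using P Q by auto
    fix v :: "complex vec" assume v: "v \<in> carrier_vec ?N"
    define \<phi> where "\<phi> = ?P *\<^sub>v v"
    have \<phi>: "\<phi> \<in> carrier_vec ?N" using P v by (auto simp: \<phi>_def)
    have P\<phi>: "?P *\<^sub>v \<phi> = \<phi>"
      unfolding \<phi>_def using P v PP by (simp add: assoc_mult_mat_vec[of _ ?N ?N _ ?N, symmetric])
    have Q\<phi>: "?Q *\<^sub>v \<phi> \<in> carrier_vec ?N" using Q \<phi> by auto
    have "?P * ?Q * ?P *\<^sub>v v = ?P *\<^sub>v (?Q *\<^sub>v \<phi>)"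
      unfolding \<phi>_def using P Q v by (simp add: assoc_mult_mat_vec[of _ ?N ?N _ ?N])
    then have "(?P * ?Q * ?P *\<^sub>v v) \<bullet>c v = (?Q *\<^sub>v \<phi>) \<bullet>c \<phi>"
      using hermitian_inner[OF hP Q\<phi> v] by (simp add: \<phi>_def)
    also have "\<dots> = ?c * (\<phi> \<bullet>c \<phi>)"
      by (rule complementary_unbiased[OF A B compl x y \<phi> P\<phi>])
    finally have 1: "(?P * ?Q * ?P *\<^sub>v v) \<bullet>c v = ?c * (\<phi> \<bullet>c \<phi>)" .
    have "\<phi> \<bullet>c v = \<phi> \<bullet>c \<phi>"
      using hermitian_inner[OF hP \<phi> v] P\<phi> by (simp add: \<phi>_def)
    then have 2: "((- ?c) \<cdot>\<^sub>m ?P *\<^sub>v v) \<bullet>c v = - ?c * (\<phi> \<bullet>c \<phi>)"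
      using P v \<phi> by (simp add: \<phi>_def smult_mat_mult_vec[OF P v])
    have "?X *\<^sub>v v = ?P * ?Q * ?P *\<^sub>v v + (- ?c) \<cdot>\<^sub>m ?P *\<^sub>v v"
      using P Q v by (intro add_mult_distrib_mat_vec) auto
    also have "\<dots> \<bullet>c v = (?P * ?Q * ?P *\<^sub>v v) \<bullet>c v + ((- ?c) \<cdot>\<^sub>m ?P *\<^sub>v v) \<bullet>c v"
      using v by (intro add_scalar_prod_distrib[of _ ?N] mult_mat_vec_carrier[of _ ?N ?N]
          mult_carrier_mat[OF mult_carrier_mat[OF P Q] P] smult_carrier_mat[OF P]) auto
    finally show "(?X *\<^sub>v v) \<bullet>c v = 0" unfolding 1 2 by simp
  qed
  then have *: "?X $$ (i, j) = 0" if "i < ?N" "j < ?N" for i j using that by simp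
  show ?thesis
  proof (rule eq_matI)
    fix i j assume "i < dim_row (?c \<cdot>\<^sub>m ?P)" "j < dim_col (?c \<cdot>\<^sub>m ?P)"
    with P have ij: "i < ?N" "j < ?N" by auto
    from *[OF ij] P Q ij show "(?P * ?Q * ?P) $$ (i, j) = (?c \<cdot>\<^sub>m ?P) $$ (i, j)"
      by (simp del: index_mult_mat(1))
  qed (use P Q in auto)
qed

theorem theorem4:
  fixes n m :: nat and A :: "nat \<Rightarrow> complex mat set" and \<psi> :: "complex vec" and b :: real
  assumes "n \<ge> 1" and "1 \<le> m" and "m \<le> n"
    and "b > 1"
    and "\<And>k. k \<in> {1..2 ^ n + 1} \<Longrightarrow> abelian_pauli_subgroup n (A k)"
    and "\<And>k. k \<in> {1..2 ^ n + 1} \<Longrightarrow> has_pauli_dim n (A k) m"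
    and "complementary_family n {1..2 ^ n + 1} A"
    and "pure_state n \<psi>"
  shows "1 / (2 ^ n + 1) * (\<Sum>k = 1..2 ^ n + 1. collision_entropy b n (A k) \<psi>)
           \<ge> log b ((2 ^ n + 1) / (2 ^ (n - m) + 1))"
proof -
  let ?K = "{1..2 ^ n + 1 :: nat}"
  let ?N = "2 ^ n :: nat"
  let ?M = "2 ^ m :: nat"
  define \<Omega> where "\<Omega> = {..<m} \<rightarrow>\<^sub>E {0, 1 :: int}"
  have \<Omega>: "finite \<Omega>" "card \<Omega> = 2 ^ m"
    using card_carrier_Z2_power[of m] by (auto simp: \<Omega>_def carrier_Z2_power)
  note dims = assms(5,6)
  let ?P = "\<lambda>k. joint_projector n (A k)"
  have compl: "?P k x * ?P l y * ?P k x = complex_of_real (1 / 2 ^ m) \<cdot>\<^sub>m ?P k x"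
    if "k \<in> ?K" "l \<in> ?K" "k \<noteq> l" "x \<in> \<Omega>" "y \<in> \<Omega>" for k l x y
    using that assms(7) unfolding complementary_family_def \<Omega>_def
    by (intro complementary_compress dims) auto
  have herm: "hermitian_mat ?N (?P k x)" if "k \<in> ?K" for k x
    by (rule joint_projector_measurement(1)[OF dims[OF that]])
  note car = herm[THEN hermitian_mat_carrier]
  have proj: "?P k x * ?P k y = (if x = y then ?P k x else 0\<^sub>m ?N ?N)" if "k \<in> ?K" "x \<in> \<Omega>" "y \<in> \<Omega>" for k x y
    using that unfolding \<Omega>_def by (intro joint_projector_measurement(2)[OF dims])
  have trace_mult: "mat_trace (?P k x * ?P l y) = mat_trace (?P k x) / 2 ^ m"
    if "k \<in> ?K" "l \<in> ?K" "k \<noteq> l" "x \<in> \<Omega>" "y \<in> \<Omega>" for k l x y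
  proof -
    note c = car[OF that(1), of x] car[OF that(2), of y]
    have "mat_trace (?P k x * ?P l y) = mat_trace (?P k x * (?P k x * ?P l y))"
      using c proj[OF that(1,4,4)] by (simp add: assoc_mult_mat[of _ ?N ?N _ ?N _ ?N, symmetric])
    also have "\<dots> = mat_trace (?P k x * ?P l y * ?P k x)"
      using c by (intro mat_trace_comm) auto
    finally show ?thesis
      unfolding compl[OF that] using c by (simp add: mat_trace_smult[of _ ?N])
  qed
  have trace: "mat_trace (?P k x) = complex_of_real (?N / ?M)" if "k \<in> ?K" "x \<in> \<Omega>" for k x
  proof -
    \<comment> \<open>As \<open>2 ^ n + 1\<close> is at least 2, a partner \<open>l\<close> exists.
      All its outcome projections have the trace of \<open>?P k x\<close>, and together they resolve
      the identity.\<close>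
    define l :: nat where "l = (if k = 1 then 2 else 1)"
    have l: "l \<in> ?K" "l \<noteq> k" by (auto simp: l_def)
    have "mat_trace (?P l y) = mat_trace (?P k x)" if y: "y \<in> \<Omega>" for y
      using trace_mult[of k l x y] trace_mult[of l k y x] that \<open>k \<in> ?K\<close> \<open>x \<in> \<Omega>\<close> l
        mat_trace_comm[OF car car, of k l x y] by simp
    then have "of_nat ?M * mat_trace (?P k x) = (\<Sum>y\<in>\<Omega>. mat_trace (?P l y))"
      using \<Omega> by simp
    also have "\<dots> = (\<Sum>y\<in>\<Omega>. mat_trace (?P l y * 1\<^sub>m ?N))"
      using car[OF l(1)] by (intro sum.cong refl) (metis right_mult_one_mat)
    also have "\<dots> = of_nat ?N"
      unfolding \<Omega>_def by (subst joint_projector_measurement(3)[OF dims[OF l(1)]]) (auto simp: mat_trace_one)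
    finally show ?thesis by (simp add: field_simps)
  qed
  have \<psi>: "\<psi> \<in> carrier_vec ?N" "\<psi> \<bullet>c \<psi> = 1" using assms(8) by (auto simp: pure_state_def)
  define p where "p k x = outcome_prob n (A k) (ketbra \<psi>) x" for k x
  have p: "complex_of_real (p k x) = (?P k x *\<^sub>v \<psi>) \<bullet>c \<psi>" if "k \<in> ?K" for k x
    unfolding p_def by (rule outcome_prob_ketbra[OF dims[OF that] \<psi>(1)])
  define S where "S k = (\<Sum>x\<in>\<Omega>. (p k x)\<^sup>2)" for k
  have "(\<Sum>k\<in>?K. \<Sum>x\<in>\<Omega>. ((?P k x *\<^sub>v \<psi>) \<bullet>c \<psi>)\<^sup>2) = complex_of_real (?N / ?M + 1) * (\<psi> \<bullet>c \<psi>)\<^sup>2"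
    by (rule complementary_projections_design[where K = ?K and Om = \<Omega>])
      (use \<Omega> \<psi> compl trace proj herm in auto)
  moreover have "complex_of_real (\<Sum>k\<in>?K. S k) = (\<Sum>k\<in>?K. \<Sum>x\<in>\<Omega>. ((?P k x *\<^sub>v \<psi>) \<bullet>c \<psi>)\<^sup>2)"
    unfolding S_def of_real_sum of_real_power by (intro sum.cong refl) (simp only: p)
  ultimately have "complex_of_real (\<Sum>k\<in>?K. S k) = complex_of_real (?N / ?M + 1)"
    using \<psi> by simp
  \<comment> \<open>\<open>m \<le> n\<close> turns the quotient of powers into a power with natural
    subtraction.\<close>
  then have sumS: "(\<Sum>k\<in>?K. S k) = 2 ^ (n - m) + 1"
    using assms(3) by (simp only: of_real_eq_iff) (simp add: power_diff)
  \<comment> \<open>The probabilities sum to the trace of the state, which is 1, so they cannot all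
    vanish. The logarithmic bound below requires positive arguments.\<close>
  have Spos: "S k > 0" if k: "k \<in> ?K" for k
  proof (rule ccontr)
    assume "\<not> S k > 0"
    moreover have "S k \<ge> 0" unfolding S_def by (rule sum_nonneg) simp
    ultimately have "S k = 0" by simp
    then have "p k x = 0" if "x \<in> \<Omega>" for x
      using that \<Omega> unfolding S_def by (subst (asm) sum_nonneg_eq_0_iff) auto
    then have "complex_of_real (\<Sum>x\<in>\<Omega>. p k x) = 0" by simp
    moreover have "complex_of_real (\<Sum>x\<in>\<Omega>. p k x) = (\<Sum>x\<in>\<Omega>. mat_trace (?P k x * ketbra \<psi>))"
      unfolding of_real_sum p[OF k] mat_trace_ketbra(1)[OF car[OF k] \<psi>(1)] ..
    moreover have "\<dots> = mat_trace (ketbra \<psi>)"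
      unfolding \<Omega>_def using density_operator_ketbra[OF assms(8)]
      by (intro joint_projector_measurement(3)[OF dims[OF k]]) (simp add: density_operator_def)
    moreover have "mat_trace (ketbra \<psi>) = 1"
      using density_operator_ketbra[OF assms(8)] by (simp add: density_operator_def)
    ultimately show False by simp
  qed
  \<comment> \<open>The average of the \<open>S k\<close>, and the reciprocal of the argument of the
    logarithm in the claim.\<close>
  define s where "s = (2 ^ (n - m) + 1) / (2 ^ n + 1 :: real)"
  have s: "s > 0" unfolding s_def by (intro divide_pos_pos add_pos_pos) auto
  have cardK: "real (card ?K) = 2 ^ n + 1" by simp
  have pos: "(2 ^ n + 1 :: real) > 0" by (simp add: add_pos_pos)
  \<comment> \<open>Jensen's inequality by hand: the tangent of \<open>ln\<close> at the average
    \<open>s\<close> lies above the graph, and its linear terms cancel in the sum.\<close>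
  have "ln (S k) \<le> ln s + (S k / s - 1)" if "k \<in> ?K" for k
    using ln_le_minus_one[of "S k / s"] Spos[OF that] s by (simp add: ln_div)
  then have "(\<Sum>k\<in>?K. ln (S k)) \<le> (\<Sum>k\<in>?K. ln s + (S k / s - 1))" by (rule sum_mono)
  also have "\<dots> = (2 ^ n + 1) * ln s + ((\<Sum>k\<in>?K. S k) / s - (2 ^ n + 1))"
    by (simp only: sum.distrib sum_subtractf sum_constant cardK sum_divide_distrib[symmetric]) simp
  also have "(\<Sum>k\<in>?K. S k) / s = 2 ^ n + 1"
    unfolding sumS s_def using s[unfolded s_def] pos by (simp add: field_simps)
  finally have le: "(\<Sum>k\<in>?K. ln (S k)) \<le> (2 ^ n + 1) * ln s" by simp
  have lb: "ln b > 0" using assms(4) by simp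
  have "(\<Sum>k\<in>?K. collision_entropy b n (A k) \<psi>) = (\<Sum>k\<in>?K. - (ln (S k) / ln b))"
    by (intro sum.cong refl)
      (simp add: collision_entropy_def S_def p_def outcomes_eq[OF dims] \<Omega>_def log_def)
  also have "\<dots> = - (\<Sum>k\<in>?K. ln (S k)) / ln b"
    by (simp only: minus_divide_left[symmetric] sum_negf sum_divide_distrib)
  also have "\<dots> \<ge> - ((2 ^ n + 1) * ln s) / ln b"
    using le lb by (intro divide_right_mono) auto
  finally have "(\<Sum>k\<in>?K. collision_entropy b n (A k) \<psi>) \<ge> (2 ^ n + 1) * (- ln s / ln b)" by simp
  moreover have "log b ((2 ^ n + 1) / (2 ^ (n - m) + 1)) = - ln s / ln b"
  proof -
    have "(2 ^ n + 1) / (2 ^ (n - m) + 1) = inverse s" by (simp add: s_def)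
    then show ?thesis using s by (simp add: log_def ln_inverse)
  qed
  ultimately show ?thesis
    using pos by (simp add: pos_le_divide_eq mult.commute)
qed

end
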